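(* For all $\tau\in\mathbb{H}$, $$\big(l(\tau)^5-l(5\tau)\big)\big(l(5\tau)^2-l(5\tau)-1\big)^2=-5\,l(\tau)\,l(5\tau)\,P\big(l(\tau),l(5\tau)\big),$$ where $P(X,Y):=(Y^2-Y-1)YX^3+(3Y^2+2Y-3)X^2-(3Y^2+2Y-3)YX+Y^2-Y-1$.
   Context: For $\tau\in\mathbb{H}$ put $q=e^{2\pi i\tau}$ and let $r(\tau)=q^{1/5}\prod_{n\ge1}\frac{(1-q^{5n-1})(1-q^{5n-4})}{(1-q^{5n-2})(1-q^{5n-3})}$ be the Rogers–Ramanujan continued fraction. Define $l(\tau)=r(2\tau)/r(\tau)^2$.
   Formalization: The last term of P(X,Y) is corrected from +(Y²−Y−1) to −(Y²−Y−1): as Im τ → ∞, l(τ) and l(5τ) tend to 1, and the printed identity would then read 0 = 10. *)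

theory Defs
  imports "HOL-Analysis.Analysis"
begin

definition nome :: "complex \<Rightarrow> complex" where
  "nome \<tau> = exp (2 * complex_of_real pi * \<i> * \<tau>)"

(* The Rogers-Ramanujan continued fraction, meaningful for Im \<tau> > 0.
   The fifth root q^{1/5} is exp (2 pi i \<tau> / 5), the branch that is holomorphic in \<tau>.
   The product over n >= 1 is indexed by Suc n, so the natural-number subtractions
   in the exponents never truncate. *)
definition rr_cfrac :: "complex \<Rightarrow> complex" where
  "rr_cfrac \<tau> = exp (2 * complex_of_real pi * \<i> * \<tau> / 5) *
     (\<Prod>n. ((1 - nome \<tau> ^ (5 * Suc n - 1)) * (1 - nome \<tau> ^ (5 * Suc n - 4))) /
           ((1 - nome \<tau> ^ (5 * Suc n - 2)) * (1 - nome \<tau> ^ (5 * Suc n - 3))))"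

definition rr_l :: "complex \<Rightarrow> complex" where
  "rr_l \<tau> = rr_cfrac (2 * \<tau>) / rr_cfrac \<tau> ^ 2"

(* The source prints the last term as + (Y^2 - Y - 1). That is a sign error: as
   Im \<tau> tends to infinity, rr_l \<tau> and rr_l (5 * \<tau>) tend to 1, and at X = Y = 1 the
   printed identity would read 0 = 10. The term must be - (Y^2 - Y - 1). *)
definition rr_P :: "complex \<Rightarrow> complex \<Rightarrow> complex" where
  "rr_P X Y = (Y^2 - Y - 1) * Y * X^3 + (3 * Y^2 + 2 * Y - 3) * X^2
     - (3 * Y^2 + 2 * Y - 3) * Y * X - (Y^2 - Y - 1)"

end

theory Submission
  imports Defs "HOL-Complex_Analysis.Complex_Analysis" "HOL-Library.Nat_Bijection"
begin

text \<open>
  Put \<open>a = r(5\<tau>)\<close>, \<open>b = r(10\<tau>)\<close>, \<open>X = l(\<tau>)\<close> and \<open>Y = l(5\<tau>) = b / a\<^sup>2\<close>. Two instances of Weierstrass'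
  three-term relation for theta functions of nome \<open>q\<^sup>1\<^sup>0\<close> show \<open>l = (1 + k) / (1 - k)\<close> with
  \<open>k = r(\<tau>) r(2\<tau>)\<^sup>2\<close>, and that \<open>l - 1 / l\<close> is an eta quotient. Applied at \<open>5\<tau>\<close>, the former reads
  \<open>a\<^sup>5 Y\<^sup>2 (Y + 1) = Y - 1\<close>. The quintuple product turns the 5-dissection of the pentagonal number
  series into \<open>\<eta>(\<tau>) / \<eta>(25\<tau>) = 1 / a - 1 - a\<close>; multiplying over the fifth roots of unity gives
  \<open>(\<eta>(5\<tau>) / \<eta>(25\<tau>))\<^sup>6 = 1 / a\<^sup>5 - 11 - a\<^sup>5\<close>. Hence \<open>X - 1 / X\<close> is an explicit rational function of
  \<open>a\<close> and \<open>Y\<close>, so \<open>X\<close> is one of the two roots \<open>N / D\<close> and \<open>- D / N\<close> of a quadratic equation. Near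
  \<open>q = 0\<close> it is the first one, since \<open>X\<close> tends to 1. The quintic then follows near \<open>q = 0\<close> by reducing
  modulo the relation between \<open>a\<close> and \<open>Y\<close>, and everywhere by the identity theorem.
\<close>

section \<open>The Jacobi triple product\<close>

definition qpoch :: "complex \<Rightarrow> complex \<Rightarrow> complex" where
  "qpoch z q = (\<Prod>n. 1 - z * q ^ n)"

text \<open>Euler's function: for q the nome of \<tau>, this is the Dedekind eta function at \<tau>
  without its factor q^(1/24).\<close>

definition euler_phi :: "complex \<Rightarrow> complex" where
  "euler_phi q = qpoch q q"

text \<open>The theta function in multiplicative notation, without the factor
  \<open>euler_phi q\<close> of the triple product. For 0 < |q| < 1 its zeros in z \<noteq> 0 are
  the integral powers of q.\<close>

definition jtheta :: "complex \<Rightarrow> complex \<Rightarrow> complex" where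
  "jtheta z q = qpoch z q * qpoch (q / z) q"

section \<open>Convergence and non-vanishing of the infinite products\<close>

lemma convergent_prod_qpoch:
  fixes q z :: complex
  assumes "norm q < 1"
  shows "convergent_prod (\<lambda>n. 1 - z * q ^ n)"
proof -
  have "summable (\<lambda>n. norm (- (z * q ^ n)))"
    using assms by (simp add: norm_mult norm_power summable_mult summable_geometric)
  hence "abs_convergent_prod (\<lambda>n. 1 + - (z * q ^ n))"
    by (intro summable_imp_abs_convergent_prod) simp
  thus ?thesis
    by (simp add: abs_convergent_prod_imp_convergent_prod)
qed

lemma has_prod_qpoch:
  "norm q < 1 \<Longrightarrow> (\<lambda>n. 1 - z * q ^ n) has_prod qpoch z q"
  unfolding qpoch_def using convergent_prod_qpoch by (intro convergent_prod_has_prod)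

lemma qpoch_LIMSEQ:
  assumes "norm q < 1"
  shows "(\<lambda>m. \<Prod>n<m. 1 - z * q ^ n) \<longlonglongrightarrow> qpoch z q"
  using has_prod_imp_tendsto'[OF has_prod_qpoch[OF assms]] .

lemma qpoch_eqI:
  assumes "norm q < 1" "(\<lambda>m. \<Prod>n<m. 1 - z * q ^ n) \<longlonglongrightarrow> x"
  shows "qpoch z q = x"
  using LIMSEQ_unique[OF qpoch_LIMSEQ[OF assms(1)] assms(2)] .

lemma qpoch_nonzero:
  assumes "norm q < 1" "\<And>n. z * q ^ n \<noteq> 1"
  shows "qpoch z q \<noteq> 0"
  unfolding qpoch_def
  by (rule prodinf_nonzero) (use assms in \<open>auto intro: convergent_prod_qpoch\<close>)

lemma qpoch_power_nonzero:
  assumes "norm q < 1" "0 < k" "0 < m"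
  shows "qpoch (q ^ k) (q ^ m) \<noteq> 0"
proof (rule qpoch_nonzero)
  show "norm (q ^ m) < 1"
    using assms by (simp add: norm_power power_less_one_iff)
  show "q ^ k * (q ^ m) ^ n \<noteq> 1" for n
  proof
    assume "q ^ k * (q ^ m) ^ n = 1"
    hence "norm q ^ (k + m * n) = 1"
      by (metis norm_one norm_power power_add power_mult)
    thus False using assms power_less_one_iff[of "norm q" "k + m * n"] by simp
  qed
qed

lemma euler_phi_nonzero: "norm q < 1 \<Longrightarrow> euler_phi q \<noteq> 0"
  using qpoch_power_nonzero[of q 1 1] by (simp add: euler_phi_def)

section \<open>Bilateral series with triangular exponents\<close>

lemma has_sum_int_shift:
  "((\<lambda>k::int. f (k + c)) has_sum S) UNIV \<longleftrightarrow> (f has_sum S) UNIV"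
  by (rule has_sum_reindex_bij_witness[of _ "\<lambda>k. k - c" "\<lambda>k. k + c"]) auto

definition tri :: "int \<Rightarrow> int" where "tri n = n * (n - 1) div 2"

lemma two_tri: "2 * tri n = n * (n - 1)"
  unfolding tri_def by (cases "even n") auto

lemma tri_eqI: "2 * m = n * (n - 1) \<Longrightarrow> tri n = m"
  using two_tri[of n] by linarith

lemma tri_Suc: "tri (n + 1) = tri n + n"
  by (rule tri_eqI) (use two_tri[of n] in \<open>simp add: algebra_simps\<close>)

lemma tri_minus: "tri (- n) = tri n + n"
  by (rule tri_eqI) (use two_tri[of n] in \<open>simp add: algebra_simps\<close>)

text \<open>Ratio test: the quotient of consecutive terms is \<open>Q ^ n * W\<close>, which tends
  to 0.\<close>

lemma summable_tri_nat:
  fixes Q W :: real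
  assumes "0 < Q" "Q < 1" "0 < W"
  shows "summable (\<lambda>n::nat. Q powi tri (int n) * W ^ n)"
proof -
  have "(\<lambda>n. Q ^ n * W) \<longlonglongrightarrow> 0 * W"
    using assms by (intro tendsto_intros LIMSEQ_power_zero) auto
  hence "eventually (\<lambda>n. Q ^ n * W < 1/2) sequentially"
    by (intro order_tendstoD) auto
  then obtain N where N: "\<And>n. n \<ge> N \<Longrightarrow> Q ^ n * W < 1/2"
    by (auto simp: eventually_at_top_linorder)
  show ?thesis
  proof (rule summable_ratio_test[where N = N and c = "1/2"])
    fix n assume "n \<ge> N"
    have "tri (int (Suc n)) = tri (int n) + int n"
      using tri_Suc[of "int n"] by (simp add: add.commute)
    hence "Q powi tri (int (Suc n)) * W ^ Suc n = (Q powi tri (int n) * W ^ n) * (Q ^ n * W)"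
      using assms by (simp add: power_int_add)
    also have "\<dots> \<le> (Q powi tri (int n) * W ^ n) * (1/2)"
      using N[OF \<open>n \<ge> N\<close>] assms by (intro mult_left_mono) (auto intro!: mult_nonneg_nonneg)
    finally show "norm (Q powi tri (int (Suc n)) * W ^ Suc n) \<le> 1/2 * norm (Q powi tri (int n) * W ^ n)"
      using assms by (simp add: abs_mult)
  qed auto
qed

text \<open>Because of \<open>tri_minus\<close>, the half over the negative indices is the half over
  the positive ones with W replaced by \<open>Q / W\<close>. The set difference keeps the index 0
  from being counted twice.\<close>

lemma summable_tri_int:
  fixes Q W :: real
  assumes "0 < Q" "Q < 1" "0 < W"
  shows "(\<lambda>k::int. Q powi tri k * W powi k) summable_on UNIV"
proof -
  let ?f = "\<lambda>k::int. Q powi tri k * W powi k"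
  have "(\<lambda>n::nat. ?f (int n)) summable_on UNIV"
    using summable_tri_nat[OF assms] assms
    by (intro norm_summable_imp_summable_on) (simp add: abs_mult)
  hence 1: "?f summable_on range int"
    by (subst summable_on_reindex) (auto simp: o_def)
  have "?f (- int n) = Q powi tri (int n) * (Q / W) ^ n" for n
    using assms by (simp add: tri_minus power_int_add power_int_minus power_divide field_simps)
  hence "(\<lambda>n::nat. ?f (- int n)) summable_on UNIV"
    using summable_tri_nat[of Q "Q / W"] assms
    by (intro norm_summable_imp_summable_on) (simp add: abs_mult)
  hence 2: "?f summable_on range (\<lambda>n. - int n)"
    by (subst summable_on_reindex) (auto simp: o_def inj_on_def)
  have "?f summable_on (range int \<union> (range (\<lambda>n. - int n) - range int))"
    using 1 summable_on_subset_banach[OF 2] by (intro summable_on_Un_disjoint) auto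
  also have "range int \<union> (range (\<lambda>n. - int n) - range int) = UNIV"
  proof -
    have "k \<in> range int \<or> k \<in> range (\<lambda>n. - int n)" for k :: int
      by (cases k rule: int_cases2) auto
    thus ?thesis by blast
  qed
  finally show ?thesis .
qed

text \<open>Extending the reciprocal of \<open>(q;q)\<^sub>k\<close> by 0 to negative \<open>k\<close> makes the recurrence
  \<open>qfact_inv_diff\<close> hold for every integer, so that finite theta sums can be treated as sums over
  all of \<open>\<int>\<close>.\<close>

definition qfact :: "complex \<Rightarrow> nat \<Rightarrow> complex" where
  "qfact q m = (\<Prod>n<m. 1 - q * q ^ n)"

definition qfact_inv :: "complex \<Rightarrow> int \<Rightarrow> complex" where
  "qfact_inv q k = (if k < 0 then 0 else inverse (qfact q (nat k)))"

lemma qfact_nonzero: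
  assumes "norm q < 1"
  shows "qfact q m \<noteq> 0"
proof -
  have "q * q ^ n \<noteq> 1" for n
  proof
    assume "q * q ^ n = 1"
    hence "norm q ^ Suc n = 1"
      by (metis norm_one norm_power power_Suc)
    thus False using assms power_less_one_iff[of "norm q" "Suc n"] by simp
  qed
  thus ?thesis by (auto simp: qfact_def)
qed

text \<open>At k = 0 the factor \<open>1 - q powi k\<close> vanishes, so the value 0 at -1 fits the
  recurrence.\<close>

lemma qfact_inv_diff:
  assumes "norm q < 1" "q \<noteq> 0"
  shows "qfact_inv q (k - 1) = (1 - q powi k) * qfact_inv q k"
proof (cases "k \<le> 0")
  case True
  thus ?thesis by (cases "k = 0") (auto simp: qfact_inv_def)
next
  case False
  then obtain m where k: "k = int (Suc m)"
    by (metis not_le pos_int_cases Suc_pred)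
  have "q * q ^ m \<noteq> 1"
    using qfact_nonzero[OF assms(1), of "Suc m"] by (auto simp: qfact_def)
  moreover have "q powi k = q * q ^ m"
    unfolding k power_int_of_nat by simp
  moreover have "nat (k - 1) = m" "nat k = Suc m" "\<not> k < 0" "\<not> k - 1 < 0"
    unfolding k by auto
  ultimately show ?thesis
    using qfact_nonzero[OF assms(1), of m] by (simp add: qfact_inv_def qfact_def)
qed

text \<open>The first three factors of the summand form the Gaussian binomial coefficient of m + n
  over n + k. A further factor of either product is absorbed by one of the two q-Pascal rules, so
  the identity follows by induction on n and then on m.\<close>

lemma finite_jacobi_triple_product:
  fixes q z :: complex
  assumes q: "norm q < 1" "q \<noteq> 0" and z: "z \<noteq> 0"
  shows "((\<lambda>k. qfact q (m + n) * qfact_inv q (int n + k) * qfact_inv q (int m - k) *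
             (q powi tri k * (- z) powi k)) has_sum
           ((\<Prod>j<m. 1 - z * q ^ j) * (\<Prod>j<n. 1 - q / z * q ^ j))) UNIV"
proof -
  define T where "T = (\<lambda>m n k. qfact q (m + n) * qfact_inv q (int n + k) * qfact_inv q (int m - k) *
             (q powi tri k * (- z) powi k))"
  have step_m: "T (Suc m) n k = T m n k + (- z * q ^ m) * T m n (k - 1)" for m n k
  proof -
    let ?A = "qfact_inv q (int n + k)" and ?B = "qfact_inv q (int m - k + 1)"
    have 1: "qfact_inv q (int n + (k - 1)) = (1 - q powi (int n + k)) * ?A"
      using qfact_inv_diff[OF q, of "int n + k"] by (simp add: algebra_simps)
    have 2: "qfact_inv q (int m - k) = (1 - q powi (int m - k + 1)) * ?B"
      using qfact_inv_diff[OF q, of "int m - k + 1"] by simp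
    have 3: "qfact_inv q (int (Suc m) - k) = ?B" "qfact_inv q (int m - (k - 1)) = ?B"
      by (simp_all add: algebra_simps)
    have tri: "tri k = tri (k - 1) + (k - 1)"
      using tri_Suc[of "k - 1"] by simp
    have e: "q ^ m * (q powi tri (k - 1)) = q powi (int m - k + 1) * q powi tri k"
      using q tri by (simp flip: power_int_add power_int_of_nat)
    have zk: "(- z) powi k = (- z) powi (k - 1) * (- z)"
      using power_int_add_1[of "- z" "k - 1"] z by simp
    have qq: "q * q ^ (m + n) = q powi (int m - k + 1) * q powi (int n + k)"
      using q(2) power_int_of_nat[of q "Suc (m + n)"]
      by (simp flip: power_int_add add: algebra_simps)
    \<comment> \<open>With u = \<open>q powi (int m - k + 1)\<close> and v =
      \<open>q powi (int n + k)\<close>, the bracket collapses by (1 - u) + u (1 - v) = 1 - u v, and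
      u v = q^(m + n + 1).\<close>
    have "T m n k + (- z * q ^ m) * T m n (k - 1) = qfact q (m + n) * ?A * ?B * (- z) powi k *
       ((1 - q powi (int m - k + 1)) * q powi tri k +
        (1 - q powi (int n + k)) * (q ^ m * q powi tri (k - 1)))"
      unfolding T_def 1 2 3 zk by (simp add: algebra_simps)
    also have "\<dots> = qfact q (m + n) * ?A * ?B * (- z) powi k * q powi tri k * (1 - q * q ^ (m + n))"
      unfolding e qq by (simp add: algebra_simps)
    also have "\<dots> = T (Suc m) n k"
      unfolding T_def 3 by (simp add: qfact_def algebra_simps)
    finally show ?thesis ..
  qed
  have step_n: "T m (Suc n) k = T m n k + (- q / z * q ^ n) * T m n (k + 1)" for m n k
  proof -
    let ?A = "qfact_inv q (int n + k + 1)" and ?B = "qfact_inv q (int m - k)"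
    have 1: "qfact_inv q (int n + k) = (1 - q powi (int n + k + 1)) * ?A"
      using qfact_inv_diff[OF q, of "int n + k + 1"] by simp
    have 2: "qfact_inv q (int m - (k + 1)) = (1 - q powi (int m - k)) * ?B"
      using qfact_inv_diff[OF q, of "int m - k"] by (simp add: algebra_simps)
    have 3: "qfact_inv q (int (Suc n) + k) = ?A" "qfact_inv q (int n + (k + 1)) = ?A"
      by (simp_all add: algebra_simps)
    have e: "q * q ^ n * (q powi tri (k + 1)) = q powi (int n + k + 1) * q powi tri k"
    proof -
      have "q * q ^ n = q powi (int n + 1)"
        using power_int_of_nat[of q "Suc n"] by (simp add: add.commute)
      thus ?thesis
        using q(2) tri_Suc[of k] by (simp add: algebra_simps flip: power_int_add)
    qed
    have zk: "(- z) powi (k + 1) = (- z) powi k * (- z)"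
      using power_int_add_1[of "- z" k] z by simp
    have qq: "q * q ^ (m + n) = q powi (int m - k) * q powi (int n + k + 1)"
      using q(2) power_int_of_nat[of q "Suc (m + n)"]
      by (simp flip: power_int_add add: algebra_simps)
    have "T m n k + (- q / z * q ^ n) * T m n (k + 1) = qfact q (m + n) * ?A * ?B * (- z) powi k *
       ((1 - q powi (int n + k + 1)) * q powi tri k +
        (1 - q powi (int m - k)) * (q * q ^ n * q powi tri (k + 1)))"
      unfolding T_def 1 2 3 zk using z by (simp add: field_simps)
    also have "\<dots> = qfact q (m + n) * ?A * ?B * (- z) powi k * q powi tri k * (1 - q * q ^ (m + n))"
      unfolding e qq by (simp add: algebra_simps)
    also have "\<dots> = T m (Suc n) k"
      unfolding T_def 3 by (simp add: qfact_def algebra_simps)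
    finally show ?thesis ..
  qed
  have base: "(T 0 0 has_sum 1) UNIV"
  proof -
    have "(T 0 0 has_sum 1) {0}"
      by (rule has_sum_finiteI) (auto simp: T_def qfact_def qfact_inv_def tri_def)
    moreover have "T 0 0 k = 0" if "k \<noteq> 0" for k
      using that by (cases "k < 0") (auto simp: T_def qfact_inv_def)
    ultimately show ?thesis
      by (subst has_sum_cong_neutral[of "{0}" UNIV _ "T 0 0"]) auto
  qed
  have "(T 0 n has_sum (\<Prod>j<n. 1 - q / z * q ^ j)) UNIV" for n
  proof (induction n)
    case 0
    thus ?case using base by simp
  next
    case (Suc n)
    have "((\<lambda>k. T 0 n k + (- q / z * q ^ n) * T 0 n (k + 1)) has_sum
        ((\<Prod>j<n. 1 - q / z * q ^ j) + (- q / z * q ^ n) * (\<Prod>j<n. 1 - q / z * q ^ j))) UNIV"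
      using Suc has_sum_int_shift[of "T 0 n" 1] by (intro has_sum_add has_sum_cmult_right) auto
    thus ?case by (simp add: step_n algebra_simps)
  qed
  hence "(T m n has_sum ((\<Prod>j<m. 1 - z * q ^ j) * (\<Prod>j<n. 1 - q / z * q ^ j))) UNIV"
  proof (induction m)
    case 0
    thus ?case by simp
  next
    case (Suc m)
    let ?S = "(\<Prod>j<m. 1 - z * q ^ j) * (\<Prod>j<n. 1 - q / z * q ^ j)"
    have "((\<lambda>k. T m n k + (- z * q ^ m) * T m n (k + - 1)) has_sum
        (?S + (- z * q ^ m) * ?S)) UNIV"
      using Suc has_sum_int_shift[of "T m n" "- 1"] by (intro has_sum_add has_sum_cmult_right) auto
    thus ?case by (simp add: step_m algebra_simps)
  qed
  thus ?thesis unfolding T_def .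
qed

text \<open>Both lengths in the finite form tend to infinity together. Each Gaussian binomial
  coefficient tends to 1 / \<open>euler_phi q\<close>, and Tannery's theorem moves the limit inside
  the sum.\<close>

theorem jacobi_triple_product:
  fixes q z :: complex
  assumes q: "norm q < 1" "q \<noteq> 0" and z: "z \<noteq> 0"
  shows "((\<lambda>k. q powi tri k * (- z) powi k) has_sum euler_phi q * jtheta z q) UNIV"
proof -
  let ?g = "\<lambda>k. q powi tri k * (- z) powi k"
  define G where "G = (\<lambda>k. norm (?g k))"
  have "G = (\<lambda>k. norm q powi tri k * norm z powi k)"
    by (auto simp: G_def norm_mult norm_power_int)
  hence G: "G summable_on UNIV"
    using summable_tri_int[of "norm q" "norm z"] q z by simp
  have g_sum: "?g summable_on UNIV"
    using G unfolding G_def by (rule abs_summable_summable)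
  have lim: "qfact q \<longlonglongrightarrow> euler_phi q"
    unfolding qfact_def euler_phi_def using qpoch_LIMSEQ[OF q(1)] by blast
  have lim_inv: "(\<lambda>n. inverse (qfact q n)) \<longlonglongrightarrow> inverse (euler_phi q)"
    using lim euler_phi_nonzero[OF q(1)] by (rule tendsto_inverse)
  \<comment> \<open>Convergent sequences are bounded; B and C give a majorant of the summands that
    is uniform in n.\<close>
  obtain B where B: "\<And>n. norm (qfact q n) \<le> B"
    using convergentI[OF lim, THEN convergent_imp_Bseq] by (auto simp: Bseq_def)
  obtain C where C: "C > 0" "\<And>n. norm (inverse (qfact q n)) \<le> C"
    using convergentI[OF lim_inv, THEN convergent_imp_Bseq] by (auto simp: Bseq_def)
  have C': "norm (qfact_inv q k) \<le> C" for k
    using C by (auto simp: qfact_inv_def)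
  have B0: "0 \<le> B" using B[of 0] norm_ge_zero order_trans by blast
  \<comment> \<open>\<open>int_decode\<close> enumerates the integers, which makes the sum over all
    integers an ordinary series.\<close>
  define a where "a = (\<lambda>j n. qfact q (n + n) * qfact_inv q (int n + int_decode j) *
      qfact_inv q (int n - int_decode j) * ?g (int_decode j))"
  define b where "b = (\<lambda>j. inverse (euler_phi q) * ?g (int_decode j))"
  have bij: "bij_betw int_decode UNIV UNIV" by (rule bij_int_decode)
  have "(\<lambda>n. a j n) \<longlonglongrightarrow> b j" for j
  proof -
    define k where "k = int_decode j"
    have l2: "(\<lambda>n. qfact_inv q (int n + k)) \<longlonglongrightarrow> inverse (euler_phi q)" for k
    proof -
      have "(\<lambda>n. inverse (qfact q (nat (int n + k)))) \<longlonglongrightarrow> inverse (euler_phi q)"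
      proof (rule filterlim_compose[OF lim_inv])
        show "filterlim (\<lambda>n. nat (int n + k)) sequentially sequentially"
          unfolding filterlim_at_top
        proof
          fix Z
          show "eventually (\<lambda>n. Z \<le> nat (int n + k)) sequentially"
            using eventually_ge_at_top[of "Z + nat \<bar>k\<bar>"] by eventually_elim linarith
        qed
      qed
      moreover have "eventually (\<lambda>n. inverse (qfact q (nat (int n + k))) = qfact_inv q (int n + k)) sequentially"
        using eventually_ge_at_top[of "nat \<bar>k\<bar>"] by eventually_elim (auto simp: qfact_inv_def)
      ultimately show ?thesis by (rule Lim_transform_eventually)
    qed
    have l1: "(\<lambda>n. qfact q (n + n)) \<longlonglongrightarrow> euler_phi q"
      by (rule filterlim_compose[OF lim])
         (auto intro!: filterlim_subseq simp: strict_mono_def)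
    have "(\<lambda>n. qfact q (n + n) * qfact_inv q (int n + k) * qfact_inv q (int n + - k) * ?g k) \<longlonglongrightarrow>
        euler_phi q * inverse (euler_phi q) * inverse (euler_phi q) * ?g k"
      by (intro tendsto_intros l1 l2)
    thus ?thesis
      using euler_phi_nonzero[OF q(1)] by (simp add: a_def b_def k_def)
  qed
  moreover have "eventually (\<lambda>(j, n). norm (a j n) \<le> B * C * C * G (int_decode j)) (at_top \<times>\<^sub>F sequentially)"
  proof (rule always_eventually, clarify)
    fix j n
    have "norm (a j n) = norm (qfact q (n + n)) * norm (qfact_inv q (int n + int_decode j)) *
       norm (qfact_inv q (int n - int_decode j)) * G (int_decode j)"
      by (simp add: a_def G_def norm_mult)
    also have "\<dots> \<le> B * C * C * G (int_decode j)"
      using B C' C(1) B0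
      by (intro mult_right_mono mult_mono) (auto simp: G_def)
    finally show "norm (a j n) \<le> B * C * C * G (int_decode j)" .
  qed
  moreover have "summable (\<lambda>j. B * C * C * G (int_decode j))"
  proof -
    have "(\<lambda>j. G (int_decode j)) summable_on UNIV"
      using G bij by (subst summable_on_reindex_bij_betw[OF bij])
    hence "summable (\<lambda>j. G (int_decode j))"
      by (intro summable_on_imp_summable)
    thus ?thesis by (intro summable_mult)
  qed
  ultimately have *: "(\<lambda>n. suminf (\<lambda>j. a j n)) \<longlonglongrightarrow> suminf b"
    using tannerys_theorem[of a b sequentially "\<lambda>j. B * C * C * G (int_decode j)"] by simp
  have "suminf (\<lambda>j. a j n) = (\<Prod>j<n. 1 - z * q ^ j) * (\<Prod>j<n. 1 - q / z * q ^ j)" for n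
  proof -
    have "((\<lambda>j. a j n) has_sum ((\<Prod>j<n. 1 - z * q ^ j) * (\<Prod>j<n. 1 - q / z * q ^ j))) UNIV"
      unfolding a_def
      using finite_jacobi_triple_product[OF q z, of n n]
        has_sum_reindex_bij_betw[OF bij, of "\<lambda>k. qfact q (n + n) * qfact_inv q (int n + k) *
          qfact_inv q (int n - k) * ?g k"] by simp
    thus ?thesis
      using has_sum_imp_sums sums_unique by metis
  qed
  with * have "(\<lambda>n. (\<Prod>j<n. 1 - z * q ^ j) * (\<Prod>j<n. 1 - q / z * q ^ j)) \<longlonglongrightarrow> suminf b"
    by simp
  moreover have "(\<lambda>n. (\<Prod>j<n. 1 - z * q ^ j) * (\<Prod>j<n. 1 - q / z * q ^ j)) \<longlonglongrightarrow> jtheta z q"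
    unfolding jtheta_def by (intro tendsto_mult qpoch_LIMSEQ q)
  ultimately have "suminf b = jtheta z q"
    by (rule LIMSEQ_unique)
  moreover have "(b has_sum inverse (euler_phi q) * infsum ?g UNIV) UNIV"
  proof -
    have "((\<lambda>j. ?g (int_decode j)) has_sum infsum ?g UNIV) UNIV"
      using g_sum has_sum_reindex_bij_betw[OF bij, of ?g] by simp
    thus ?thesis unfolding b_def by (rule has_sum_cmult_right)
  qed
  hence "suminf b = inverse (euler_phi q) * infsum ?g UNIV"
    using has_sum_imp_sums sums_unique by metis
  ultimately have "infsum ?g UNIV = euler_phi q * jtheta z q"
    using euler_phi_nonzero[OF q(1)] by (simp add: field_simps)
  thus ?thesis
    using g_sum by (metis has_sum_infsum)
qed

section \<open>Theta functions and the three-term relation\<close>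

text \<open>The factors are sorted by the residue class of their index modulo m. The partial
  products of length N * m are a subsequence of those of \<open>qpoch z q\<close>.\<close>

lemma qpoch_split:
  assumes "norm q < 1" "0 < m"
  shows "qpoch z q = (\<Prod>j<m. qpoch (z * q ^ j) (q ^ m))"
proof (rule qpoch_eqI)
  have qm: "norm (q ^ m) < 1"
    using assms by (simp add: norm_power power_less_one_iff)
  define F where "F = (\<lambda>N. \<Prod>n<N. 1 - z * q ^ n)"
  have "(\<lambda>N. \<Prod>j<m. \<Prod>n<N. 1 - z * q ^ j * (q ^ m) ^ n) \<longlonglongrightarrow>
      (\<Prod>j<m. qpoch (z * q ^ j) (q ^ m))"
    by (intro tendsto_prod qpoch_LIMSEQ qm)
  moreover have "(\<Prod>j<m. \<Prod>n<N. 1 - z * q ^ j * (q ^ m) ^ n) = F (N * m)" for N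
  proof -
    have "F (N * m) = (\<Prod>n<N. \<Prod>j=n*m..<n*m+m. 1 - z * q ^ j)"
      unfolding F_def by (rule prod.nat_group[symmetric])
    also have "\<dots> = (\<Prod>n<N. \<Prod>j<m. 1 - z * q ^ j * (q ^ m) ^ n)"
    proof (rule prod.cong[OF refl])
      fix n
      have "(\<Prod>j=0+n*m..<m+n*m. 1 - z * q ^ j) = (\<Prod>j=0..<m. 1 - z * q ^ (j + n * m))"
        by (rule prod.shift_bounds_nat_ivl)
      thus "(\<Prod>j=n*m..<n*m+m. 1 - z * q ^ j) = (\<Prod>j<m. 1 - z * q ^ j * (q ^ m) ^ n)"
        by (simp add: power_add power_mult mult.commute[of n m] add.commute lessThan_atLeast0 mult.assoc)
    qed
    also have "\<dots> = (\<Prod>j<m. \<Prod>n<N. 1 - z * q ^ j * (q ^ m) ^ n)"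
      by (rule prod.swap)
    finally show ?thesis ..
  qed
  ultimately have 1: "(\<lambda>N. F (N * m)) \<longlonglongrightarrow> (\<Prod>j<m. qpoch (z * q ^ j) (q ^ m))"
    by simp
  have "(\<lambda>N. F (N * m)) \<longlonglongrightarrow> qpoch z q"
    using LIMSEQ_subseq_LIMSEQ[OF qpoch_LIMSEQ[OF assms(1)], of "\<lambda>N. N * m"] assms(2)
    by (simp add: F_def o_def strict_mono_def)
  with 1 have "qpoch z q = (\<Prod>j<m. qpoch (z * q ^ j) (q ^ m))"
    using LIMSEQ_unique by blast
  thus "(\<lambda>N. \<Prod>n<N. 1 - z * q ^ n) \<longlonglongrightarrow> (\<Prod>j<m. qpoch (z * q ^ j) (q ^ m))"
    using qpoch_LIMSEQ[OF assms(1)] by metis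
qed (use assms in auto)

lemma qpoch_rec:
  assumes "norm q < 1"
  shows "qpoch z q = (1 - z) * qpoch (z * q) q"
proof (rule LIMSEQ_unique)
  show "(\<lambda>m. \<Prod>n<Suc m. 1 - z * q ^ n) \<longlonglongrightarrow> qpoch z q"
    using LIMSEQ_Suc[OF qpoch_LIMSEQ[OF assms]] .
  have "(\<lambda>m. (1 - z) * (\<Prod>n<m. 1 - z * q * q ^ n)) \<longlonglongrightarrow> (1 - z) * qpoch (z * q) q"
    by (intro tendsto_intros qpoch_LIMSEQ assms)
  thus "(\<lambda>m. \<Prod>n<Suc m. 1 - z * q ^ n) \<longlonglongrightarrow> (1 - z) * qpoch (z * q) q"
    by (subst prod.lessThan_Suc_shift) (simp add: mult.assoc)
qed

lemma qpoch_1: "norm q < 1 \<Longrightarrow> qpoch 1 q = 0"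
  using qpoch_rec[of q 1] by simp

lemma qpoch_mult_minus:
  assumes "norm q < 1"
  shows "qpoch z q * qpoch (- z) q = qpoch (z\<^sup>2) (q\<^sup>2)"
proof (rule qpoch_eqI[symmetric])
  show "norm (q\<^sup>2) < 1"
    using assms by (simp add: norm_power power_less_one_iff)
  have "(\<lambda>m. (\<Prod>n<m. 1 - z * q ^ n) * (\<Prod>n<m. 1 - (- z) * q ^ n)) \<longlonglongrightarrow> qpoch z q * qpoch (- z) q"
    by (intro tendsto_intros qpoch_LIMSEQ assms)
  moreover have "(1 - z * q ^ n) * (1 - (- z) * q ^ n) = 1 - z\<^sup>2 * (q\<^sup>2) ^ n" for n
    by (simp add: algebra_simps power2_eq_square power_mult_distrib)
  ultimately show "(\<lambda>m. \<Prod>n<m. 1 - z\<^sup>2 * (q\<^sup>2) ^ n) \<longlonglongrightarrow> qpoch z q * qpoch (- z) q"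
    by (simp flip: prod.distrib)
qed

lemma jtheta_reflect: "q \<noteq> 0 \<Longrightarrow> z \<noteq> 0 \<Longrightarrow> jtheta (q / z) q = jtheta z q"
  by (simp add: jtheta_def)

lemma jtheta_reflect_power:
  assumes "q \<noteq> 0" "i + j = m"
  shows "jtheta (q ^ i) (q ^ m) = jtheta (q ^ j) (q ^ m)"
proof -
  have "q ^ i = q ^ m / q ^ j"
    using assms by (auto simp: power_add)
  thus ?thesis using assms jtheta_reflect[of "q ^ m" "q ^ j"] by simp
qed

text \<open>After the first factors 1 - 1/z and 1 - z are split off, both sides contain the same
  products, and these factors have quotient -1/z. Serves to turn negative powers of q into positive
  ones.\<close>

lemma jtheta_inverse:
  assumes "norm q < 1" "z \<noteq> 0"
  shows "jtheta (1 / z) q = - jtheta z q / z"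
proof -
  have "jtheta (1 / z) q = (1 - 1 / z) * qpoch (q / z) q * qpoch (z * q) q"
    using qpoch_rec[OF assms(1), of "1 / z"] by (simp add: jtheta_def mult.commute)
  moreover have "jtheta z q = (1 - z) * qpoch (z * q) q * qpoch (q / z) q"
    using qpoch_rec[OF assms(1), of z] by (simp add: jtheta_def)
  ultimately show ?thesis
    using assms by (simp add: divide_simps) (simp add: algebra_simps)
qed

lemma jtheta_split:
  assumes "norm q < 1" "q \<noteq> 0" "z \<noteq> 0"
  shows "jtheta z q = jtheta z (q\<^sup>2) * jtheta (z * q) (q\<^sup>2)"
proof -
  have "qpoch w q = qpoch w (q\<^sup>2) * qpoch (w * q) (q\<^sup>2)" for w
    using qpoch_split[OF assms(1), of 2 w] by (simp add: lessThan_Suc numeral_2_eq_2)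
  from this[of z] this[of "q / z"] show ?thesis
    using assms by (simp add: jtheta_def power2_eq_square)
qed

lemma jtheta_mult_minus:
  assumes "norm q < 1"
  shows "jtheta z q * jtheta (- z) q = jtheta (z\<^sup>2) (q\<^sup>2)"
  using qpoch_mult_minus[OF assms, of z, symmetric] qpoch_mult_minus[OF assms, of "q / z", symmetric]
  by (simp add: jtheta_def power_divide mult_ac)

lemma jtheta_1: "norm q < 1 \<Longrightarrow> jtheta 1 q = 0"
  by (simp add: jtheta_def qpoch_1)

lemma jtheta_power_nonzero:
  assumes "norm q < 1" "q \<noteq> 0" "0 < i" "i < m"
  shows "jtheta (q ^ i) (q ^ m) \<noteq> 0"
proof -
  have "q ^ m / q ^ i = q ^ (m - i)"
    using assms by (simp add: power_diff)
  thus ?thesis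
    using assms qpoch_power_nonzero[of q] by (simp add: jtheta_def)
qed

text \<open>Exponents are sorted modulo 3: the multiples of 3 give \<open>euler_phi (q ^ 3)\<close>,
  the other two classes give the theta function.\<close>

lemma euler_phi_cubic:
  assumes "norm q < 1" "q \<noteq> 0"
  shows "euler_phi (q ^ 3) * jtheta q (q ^ 3) = euler_phi q"
    and "euler_phi (q ^ 3) * jtheta (q ^ 2) (q ^ 3) = euler_phi q"
proof -
  have "q ^ 3 / q = q ^ 2"
    using assms by (simp add: power2_eq_square power3_eq_cube)
  thus "euler_phi (q ^ 3) * jtheta q (q ^ 3) = euler_phi q"
    using qpoch_split[OF assms(1), of 3 q]
    by (simp add: euler_phi_def jtheta_def lessThan_Suc eval_nat_numeral mult_ac)
  thus "euler_phi (q ^ 3) * jtheta (q ^ 2) (q ^ 3) = euler_phi q"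
    using jtheta_reflect_power[OF assms(2), of 2 1 3] by simp
qed

section \<open>Products of series and rearrangement into finitely many classes\<close>

lemma has_sum_mult_prod:
  fixes f :: "'a \<Rightarrow> complex" and g :: "'b \<Rightarrow> complex"
  assumes f: "(f has_sum S) UNIV" and g: "(g has_sum T) UNIV"
    and h: "\<And>x y. h (x, y) = f x * g y"
  shows "(h has_sum S * T) UNIV"
proof -
  \<comment> \<open>Over the complex numbers summable families are absolutely summable, hence so is
    the family of products.\<close>
  have sf: "(\<lambda>x. norm (f x)) summable_on UNIV" and sg: "(\<lambda>x. norm (g x)) summable_on UNIV"
    using f g by (auto simp: has_sum_imp_summable simp flip: summable_on_iff_abs_summable_on_complex)
  have "(\<lambda>p. norm (case p of (x, y) \<Rightarrow> f x * g y)) summable_on UNIV \<times> UNIV"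
    using sf sg
    by (subst Infinite_Sum.abs_summable_on_Sigma_iff)
       (auto simp: norm_mult infsum_cmult_right' infsum_nonneg abs_mult abs_of_nonneg
             intro!: summable_on_cmult_right summable_on_cmult_left)
  hence "(\<lambda>(x, y). f x * g y) summable_on UNIV \<times> UNIV"
    by (rule abs_summable_summable)
  hence "((\<lambda>(x, y). f x * g y) has_sum S * T) (UNIV \<times> UNIV)"
    by (rule has_sum_SigmaI[where g = "\<lambda>x. f x * T", rotated 2])
       (use has_sum_cmult_right[OF g] has_sum_cmult_left[OF f] in auto)
  moreover have "h = (\<lambda>(x, y). f x * g y)"
    using h by auto
  ultimately show ?thesis by simp
qed

text \<open>Used to split a series over integers or pairs of integers into congruence classes. The
  map \<open>\<phi> i\<close> parametrises class i; \<open>di\<close> and \<open>dx\<close> recover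
  the class and the parameter.\<close>

lemma has_sum_partition:
  fixes f :: "'a \<Rightarrow> complex" and \<phi> :: "'i \<Rightarrow> 'b \<Rightarrow> 'a"
  assumes "finite I"
    and left: "\<And>i x. i \<in> I \<Longrightarrow> (di (\<phi> i x), dx (\<phi> i x)) = (i, x)"
    and right: "\<And>y. di y \<in> I \<and> \<phi> (di y) (dx y) = y"
    and sum: "\<And>i. i \<in> I \<Longrightarrow> ((\<lambda>x. f (\<phi> i x)) has_sum S i) UNIV"
  shows "(f has_sum sum S I) UNIV"
proof -
  have "(f has_sum sum S J) (\<Union>i\<in>J. range (\<phi> i))" if "J \<subseteq> I" for J
    using finite_subset[OF that \<open>finite I\<close>] that
  proof (induction J rule: finite_induct)
    case empty
    thus ?case by simp
  next
    case (insert j J)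
    have "inj (\<phi> j)"
      using left[of j] insert.prems by (metis injI insert_subset prod.inject)
    hence "(f has_sum S j) (range (\<phi> j))"
      using sum[of j] insert.prems by (subst has_sum_reindex) (auto simp: o_def)
    moreover have "range (\<phi> j) \<inter> (\<Union>i\<in>J. range (\<phi> i)) = {}"
    proof -
      have "\<phi> j x \<noteq> \<phi> i y" if "i \<in> J" for i x y
        using left[of j x] left[of i y] insert that by (metis insert_subset prod.inject subsetD)
      thus ?thesis by auto
    qed
    ultimately show ?case
      using insert by (auto intro: has_sum_Un_disjoint)
  qed
  from this[of I] have "(f has_sum sum S I) (\<Union>i\<in>I. range (\<phi> i))" by simp
  moreover have "(\<Union>i\<in>I. range (\<phi> i)) = UNIV"
  proof (intro equalityI subsetI UNIV_I)
    fix y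
    have "y = \<phi> (di y) (dx y)" "di y \<in> I"
      using right[of y] by auto
    thus "y \<in> (\<Union>i\<in>I. range (\<phi> i))" by blast
  qed
  ultimately show ?thesis by simp
qed

text \<open>\<open>even_theta\<close> and \<open>odd_theta\<close> are the parts of the series of
  q^(N^2/4) y^N with N even and with N odd, the latter divided by q^(1/4).\<close>

definition even_theta :: "complex \<Rightarrow> complex \<Rightarrow> complex" where
  "even_theta q y = euler_phi (q\<^sup>2) * jtheta (- (q * y\<^sup>2)) (q\<^sup>2)"

definition odd_theta :: "complex \<Rightarrow> complex \<Rightarrow> complex" where
  "odd_theta q y = y * (euler_phi (q\<^sup>2) * jtheta (- (q\<^sup>2 * y\<^sup>2)) (q\<^sup>2))"

lemma power_two_powi_tri: "(q\<^sup>2) powi tri n = q powi (n * (n - 1))" for q :: complex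
  using power_int_mult[of q 2 "tri n"] by (simp add: two_tri)

lemma has_sum_even_theta:
  assumes "norm q < 1" "q \<noteq> 0" "y \<noteq> 0"
  shows "((\<lambda>n. q powi (n * n) * (y\<^sup>2) powi n) has_sum even_theta q y) UNIV"
proof -
  have "norm (q\<^sup>2) < 1"
    using assms by (simp add: norm_power power_less_one_iff)
  from jacobi_triple_product[OF this, of "- (q * y\<^sup>2)"] assms
  have "((\<lambda>n. q powi (n * (n - 1)) * (q * y\<^sup>2) powi n) has_sum even_theta q y) UNIV"
    by (simp add: power_two_powi_tri even_theta_def)
  moreover have "q powi (n * (n - 1)) * (q * y\<^sup>2) powi n = q powi (n * n) * (y\<^sup>2) powi n" for n
    using assms(2) by (simp add: power_int_mult_distrib algebra_simps power_int_diff)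
  ultimately show ?thesis by simp
qed

lemma has_sum_odd_theta:
  assumes "norm q < 1" "q \<noteq> 0" "y \<noteq> 0"
  shows "((\<lambda>n. q powi (n * n + n) * (y * (y\<^sup>2) powi n)) has_sum odd_theta q y) UNIV"
proof -
  have "norm (q\<^sup>2) < 1"
    using assms by (simp add: norm_power power_less_one_iff)
  from jacobi_triple_product[OF this, of "- (q\<^sup>2 * y\<^sup>2)", THEN has_sum_cmult_right, of y] assms
  have "((\<lambda>n. y * (q powi (n * (n - 1)) * (q\<^sup>2 * y\<^sup>2) powi n)) has_sum odd_theta q y) UNIV"
    by (simp add: power_two_powi_tri odd_theta_def)
  moreover have "y * (q powi (n * (n - 1)) * (q\<^sup>2 * y\<^sup>2) powi n) =
      q powi (n * n + n) * (y * (y\<^sup>2) powi n)" for n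
  proof -
    have "(q\<^sup>2) powi n = q powi n * q powi n"
      by (simp add: power2_eq_square power_int_mult_distrib)
    thus ?thesis
      using assms(2) by (simp add: power_int_mult_distrib algebra_simps power_int_diff power_int_add)
  qed
  ultimately show ?thesis by simp
qed

lemma powi_add_mult_powi_diff:
  fixes A B :: complex
  assumes "A \<noteq> 0" "B \<noteq> 0"
  shows "A powi (i + j) * B powi (i - j) = (A * B) powi i * (A / B) powi j"
  using assms by (simp add: power_int_add power_int_diff power_int_mult_distrib power_int_divide_distrib)

text \<open>The product of two theta functions is a \<open>2 \<times> 2\<close> determinant; Weierstrass' three-term
  relation is then the Pluecker relation between the minors of a \<open>2 \<times> 4\<close> matrix.\<close>

lemma jtheta_product_determinant:
  assumes q: "norm q < 1" "q \<noteq> 0" and "x \<noteq> 0" "y \<noteq> 0"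
  shows "euler_phi q ^ 2 * (jtheta (x * y) q * jtheta (x / y) q) =
           x * (odd_theta q x * even_theta q y - even_theta q x * odd_theta q y)"
proof -
  let ?F = "\<lambda>z k. q powi tri k * (- z) powi k"
  define f where "f = (\<lambda>(m, n). ?F (x * y) m * ?F (x / y) n)"
  \<comment> \<open>Pairs (m, n) are classified by the parity e of m - n. In the coordinates i, j
    the quadratic form \<open>tri m + tri n\<close> has no mixed term, so each class factors into
    two theta series.\<close>
  define \<phi> :: "int \<Rightarrow> int \<times> int \<Rightarrow> int \<times> int" where "\<phi> = (\<lambda>e (i, j). (i + j + e, i - j))"
  define S where "S = (\<lambda>e::int. if e = 0 then x * odd_theta q x * even_theta q y
                       else - (x * even_theta q x * odd_theta q y))"
  have "(f has_sum (euler_phi q * jtheta (x * y) q) * (euler_phi q * jtheta (x / y) q)) UNIV"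
    using assms
    by (intro has_sum_mult_prod[OF jacobi_triple_product jacobi_triple_product]) (auto simp: f_def)
  moreover have "(f has_sum sum S {0, 1}) UNIV"
  proof (rule has_sum_partition[where \<phi> = \<phi> and di = "\<lambda>(m, n). (m - n) mod 2"
        and dx = "\<lambda>(m, n). (n + (m - n) div 2, (m - n) div 2)"])
    show "(case \<phi> e u of (m, n) \<Rightarrow> (m - n) mod 2,
           case \<phi> e u of (m, n) \<Rightarrow> (n + (m - n) div 2, (m - n) div 2)) = (e, u)"
      if "e \<in> {0, 1}" for e u
    proof (cases u)
      case (Pair i j)
      have "i + j + e - (i - j) = 2 * j + e" by simp
      thus ?thesis using that Pair by (auto simp: \<phi>_def)
    qed
    show "(case u of (m, n) \<Rightarrow> (m - n) mod 2) \<in> {0, 1} \<and>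
       \<phi> (case u of (m, n) \<Rightarrow> (m - n) mod 2)
         (case u of (m, n) \<Rightarrow> (n + (m - n) div 2, (m - n) div 2)) = u" for u
    proof (cases u)
      case (Pair m n)
      have "2 * ((m - n) div 2) + (m - n) mod 2 = m - n" by simp
      hence "n + (m - n) div 2 + (m - n) div 2 + (m - n) mod 2 = m" by linarith
      thus ?thesis using Pair by (auto simp: \<phi>_def)
    qed
    show "((\<lambda>u. f (\<phi> e u)) has_sum S e) UNIV" if "e \<in> {0, 1}" for e
    proof (cases "e = 0")
      case True
      \<comment> \<open>For even m - n the exponent of q in i is i * (i - 1); it is the exponent of
        the odd series shifted by one.\<close>
      have "((\<lambda>i. q powi ((i - 1) * (i - 1) + (i - 1)) * (x * (x\<^sup>2) powi (i - 1))) has_sum odd_theta q x) UNIV"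
        using has_sum_odd_theta[OF q \<open>x \<noteq> 0\<close>]
          has_sum_int_shift[of "\<lambda>i. q powi (i * i + i) * (x * (x\<^sup>2) powi i)" "- 1"] by simp
      hence "((\<lambda>i. x * (q powi ((i - 1) * (i - 1) + (i - 1)) * (x * (x\<^sup>2) powi (i - 1)))) has_sum
                x * odd_theta q x) UNIV"
        by (rule has_sum_cmult_right)
      moreover note has_sum_even_theta[OF q \<open>y \<noteq> 0\<close>]
      moreover have "f (\<phi> e (i, j)) = x * (q powi ((i - 1) * (i - 1) + (i - 1)) * (x * (x\<^sup>2) powi (i - 1))) *
              (q powi (j * j) * (y\<^sup>2) powi j)" for i j
      proof -
        have "tri (i + j) + tri (i - j) = (i - 1) * (i - 1) + (i - 1) + j * j"
          using two_tri[of "i + j"] two_tri[of "i - j"] by (simp add: algebra_simps)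
        hence "q powi tri (i + j) * q powi tri (i - j) = q powi ((i - 1) * (i - 1) + (i - 1)) * q powi (j * j)"
          using q(2) by (simp flip: power_int_add)
        moreover have "(- (x * y)) powi (i + j) * (- (x / y)) powi (i - j) = (x\<^sup>2) powi i * (y\<^sup>2) powi j"
          using assms by (subst powi_add_mult_powi_diff) (auto simp: power2_eq_square)
        moreover have "(x\<^sup>2) powi i = x * x * (x\<^sup>2) powi (i - 1)"
          using power_int_add_1'[of "x\<^sup>2" "i - 1"] assms by (simp add: power2_eq_square)
        moreover have "f (\<phi> e (i, j)) = (q powi tri (i + j) * q powi tri (i - j)) *
            ((- (x * y)) powi (i + j) * (- (x / y)) powi (i - j))"
          using True by (simp add: f_def \<phi>_def mult_ac)
        ultimately show ?thesis by (simp add: mult_ac)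
      qed
      ultimately have "((\<lambda>u. f (\<phi> e u)) has_sum (x * odd_theta q x) * even_theta q y) UNIV"
        by (rule has_sum_mult_prod)
      thus ?thesis using True by (simp add: S_def)
    next
      case False
      with that have e: "e = 1" by simp
      have "((\<lambda>i. - x * (q powi (i * i) * (x\<^sup>2) powi i)) has_sum (- x * even_theta q x)) UNIV"
        by (intro has_sum_cmult_right has_sum_even_theta q \<open>x \<noteq> 0\<close>)
      moreover note has_sum_odd_theta[OF q \<open>y \<noteq> 0\<close>]
      moreover have "f (\<phi> e (i, j)) = (- x * (q powi (i * i) * (x\<^sup>2) powi i)) *
              (q powi (j * j + j) * (y * (y\<^sup>2) powi j))" for i j
      proof -
        have "tri (i + j + 1) + tri (i - j) = i * i + (j * j + j)"
          using two_tri[of "i + j + 1"] two_tri[of "i - j"] by (simp add: algebra_simps)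
        hence "q powi tri (i + j + 1) * q powi tri (i - j) = q powi (i * i) * q powi (j * j + j)"
          using q(2) by (simp flip: power_int_add)
        moreover have "(- (x * y)) powi (i + j + 1) * (- (x / y)) powi (i - j) =
            - (x * y) * ((x\<^sup>2) powi i * (y\<^sup>2) powi j)"
        proof -
          have "(- (x * y)) powi (i + j) * (- (x / y)) powi (i - j) = (x\<^sup>2) powi i * (y\<^sup>2) powi j"
            using assms by (subst powi_add_mult_powi_diff) (auto simp: power2_eq_square)
          thus ?thesis
            using assms by (simp add: power_int_add_1 mult_ac)
        qed
        moreover have "f (\<phi> e (i, j)) = (q powi tri (i + j + 1) * q powi tri (i - j)) *
            ((- (x * y)) powi (i + j + 1) * (- (x / y)) powi (i - j))"
          using e by (simp add: f_def \<phi>_def mult_ac)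
        ultimately show ?thesis by (simp add: mult_ac)
      qed
      ultimately have "((\<lambda>u. f (\<phi> e u)) has_sum (- x * even_theta q x) * odd_theta q y) UNIV"
        by (rule has_sum_mult_prod)
      thus ?thesis using e by (simp add: S_def)
    qed
  qed auto
  ultimately have "(euler_phi q * jtheta (x * y) q) * (euler_phi q * jtheta (x / y) q) = sum S {0, 1}"
    using has_sum_unique by blast
  thus ?thesis by (simp add: S_def algebra_simps power2_eq_square)
qed

theorem weierstrass_three_term:
  assumes q: "norm q < 1" "q \<noteq> 0" and nz: "x \<noteq> 0" "y \<noteq> 0" "u \<noteq> 0" "v \<noteq> 0"
  defines "W \<equiv> (\<lambda>a b. jtheta (a * b) q * jtheta (a / b) q)"
  shows "y * (W x y * W u v) + u * (W x v * W y u) = u * (W x u * W y v)"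
proof -
  define M where "M = (\<lambda>a b. odd_theta q a * even_theta q b - even_theta q a * odd_theta q b)"
  define E where "E = euler_phi q ^ 2"
  have E: "E \<noteq> 0" using euler_phi_nonzero[OF q(1)] by (simp add: E_def)
  have W: "E * W a b = a * M a b" if "a \<noteq> 0" "b \<noteq> 0" for a b
    unfolding W_def M_def E_def using jtheta_product_determinant[OF q that] .
  have "E * E * (y * (W x y * W u v) + u * (W x v * W y u)) =
      y * ((E * W x y) * (E * W u v)) + u * ((E * W x v) * (E * W y u))"
    by (simp add: algebra_simps)
  also have "\<dots> = x * y * u * (M x y * M u v + M x v * M y u)"
    by (simp add: W nz algebra_simps)
  also have "M x y * M u v + M x v * M y u = M x u * M y v"
    unfolding M_def by (simp add: algebra_simps)
  also have "x * y * u * (M x u * M y v) = u * ((E * W x u) * (E * W y v))"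
    by (simp add: W nz)
  also have "\<dots> = E * E * (u * (W x u * W y v))"
    by (simp add: algebra_simps)
  finally show ?thesis using E by simp
qed

section \<open>The quintuple product and the 5-dissection\<close>

lemma minus_powi: "(- z) powi k = (- 1) powi k * z powi k" for z :: complex
  using power_int_mult_distrib[of "- 1" z k] by simp

lemma powi_sign_cong:
  fixes i j :: int
  assumes "even (i - j)"
  shows "(- 1 :: complex) powi i = (- 1) powi j"
  using assms by (cases "even i"; cases "even j") auto

lemma power_powi: "(q ^ m) powi k = q powi (int m * k)" for q :: complex
  by (simp add: power_int_mult)

text \<open>Multiplied by \<open>euler_phi (q ^ 2)\<close>, the left side is a product of two theta
  series. The double series is split by the exponent of z modulo 3. Each class is a theta function
  in z^3 of nome q^3 times a theta constant of nome q^6; one constant is zero and the other two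
  equal \<open>euler_phi (q ^ 2)\<close>, which cancels.\<close>

theorem quintuple_product:
  fixes q z :: complex
  assumes q: "norm q < 1" "q \<noteq> 0" and z: "z \<noteq> 0"
  shows "euler_phi q * jtheta z q * jtheta (q * z ^ 2) (q ^ 2) =
     euler_phi (q ^ 3) * (jtheta (- (q * z ^ 3)) (q ^ 3) - z * jtheta (- (q ^ 2 * z ^ 3)) (q ^ 3))"
proof -
  let ?F = "\<lambda>q z k. q powi tri k * (- z) powi k"
  have qn: "norm (q ^ n) < 1" if "n > 0" for n
    using q that by (simp add: norm_power power_less_one_iff)
  have jtp: "(?F (q ^ n) w has_sum euler_phi (q ^ n) * jtheta w (q ^ n)) UNIV" if "n > 0" "w \<noteq> 0" for n w
    using jacobi_triple_product[of "q ^ n" w] qn[of n] q that by simp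
  define f where "f = (\<lambda>(m, k). ?F q z m * ?F (q ^ 2) (q * z ^ 2) k)"
  \<comment> \<open>The solutions of m + 2 k = 3 M + e, where m + 2 k is the exponent of z. The
    constants \<open>c\<close>, \<open>A\<close> and \<open>B\<close> are read off from the
    exponents of q in M and n.\<close>
  define \<phi> :: "int \<Rightarrow> int \<times> int \<Rightarrow> int \<times> int" where "\<phi> = (\<lambda>e (M, n). (M + e - 2 * n, n + M))"
  define c where "c = (\<lambda>e::int. if e = 0 then 1 else if e = 1 then - z else q * z ^ 2)"
  define A where "A = (\<lambda>e::int. if e = 0 then - (q * z ^ 3) else if e = 1 then - (q ^ 2 * z ^ 3) else - (q ^ 3 * z ^ 3))"
  define B where "B = (\<lambda>e::int. if e = 0 then q ^ 4 else if e = 1 then q ^ 2 else 1)"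
  define S where "S = (\<lambda>e::int. (c e * (euler_phi (q ^ 3) * jtheta (A e) (q ^ 3))) *
      (euler_phi (q ^ 6) * jtheta (B e) (q ^ 6)))"
  have fnorm: "f (m, k) = (- 1) powi (m + k) * q powi (tri m + 2 * tri k + k) * z powi (m + 2 * k)" for m k
  proof -
    have "(z ^ 2) powi k = z powi (2 * k)" by (simp add: power_powi)
    moreover have "(q ^ 2) powi tri k = q powi (2 * tri k)" by (simp add: power_powi)
    ultimately show ?thesis
      using q z
      by (simp add: f_def minus_powi[of z] minus_powi[of "q * z ^ 2"] power_int_mult_distrib power_int_add mult_ac)
  qed
  have gnorm: "?F (q ^ 3) (- (q ^ i * z ^ 3)) M * ?F (q ^ 6) (q ^ j) n =
     (- 1) powi n * q powi (3 * tri M + int i * M + 6 * tri n + int j * n) * z powi (3 * M)" for i j M n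
    using q z
    by (simp add: minus_powi[of "q ^ j"] power_int_mult_distrib power_powi power_int_add mult_ac)
  have "(f has_sum (euler_phi q * jtheta z q) * (euler_phi (q ^ 2) * jtheta (q * z ^ 2) (q ^ 2))) UNIV"
    using q z jtp[of 1 z] jtp[of 2 "q * z ^ 2"]
    by (intro has_sum_mult_prod[where f = "?F q z" and g = "?F (q ^ 2) (q * z ^ 2)"]) (auto simp: f_def)
  moreover have "(f has_sum sum S {0, 1, 2}) UNIV"
  proof (rule has_sum_partition[where \<phi> = \<phi> and di = "\<lambda>(m, k). (m + 2 * k) mod 3"
        and dx = "\<lambda>(m, k). ((m + 2 * k) div 3, k - (m + 2 * k) div 3)"])
    show "(case \<phi> e u of (m, k) \<Rightarrow> (m + 2 * k) mod 3,
           case \<phi> e u of (m, k) \<Rightarrow> ((m + 2 * k) div 3, k - (m + 2 * k) div 3)) = (e, u)"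
      if "e \<in> {0, 1, 2}" for e u
    proof (cases u)
      case (Pair M n)
      have "M + e - 2 * n + 2 * (n + M) = 3 * M + e" by simp
      thus ?thesis using that Pair by (auto simp: \<phi>_def)
    qed
    show "(case u of (m, k) \<Rightarrow> (m + 2 * k) mod 3) \<in> {0, 1, 2} \<and>
       \<phi> (case u of (m, k) \<Rightarrow> (m + 2 * k) mod 3)
         (case u of (m, k) \<Rightarrow> ((m + 2 * k) div 3, k - (m + 2 * k) div 3)) = u" for u
    proof (cases u)
      case (Pair m k)
      have "D + R - 2 * (k - D) = m" if "3 * D + R = m + 2 * k" for D R
        using that by simp
      from this[of "(m + 2 * k) div 3" "(m + 2 * k) mod 3"]
      have "(m + 2 * k) div 3 + (m + 2 * k) mod 3 - 2 * (k - (m + 2 * k) div 3) = m"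
        using mult_div_mod_eq by blast
      moreover have "(m + 2 * k) mod 3 \<in> {0, 1, 2}" by auto
      ultimately show ?thesis using Pair by (auto simp: \<phi>_def)
    qed
    show "((\<lambda>u. f (\<phi> e u)) has_sum S e) UNIV" if e: "e \<in> {0, 1, 2}" for e
    proof -
      have nz: "A e \<noteq> 0" "B e \<noteq> 0"
        using q z by (auto simp: A_def B_def)
      have pt: "f (\<phi> e (M, n)) = (c e * ?F (q ^ 3) (A e) M) * ?F (q ^ 6) (B e) n" for M n
      proof -
        have sgn: "(- 1 :: complex) powi (2 * M + e - n) = (- 1) powi e * (- 1) powi n"
          using powi_sign_cong[of "2 * M + e - n" "e + n"] by (simp add: power_int_add)
        have fe: "f (\<phi> e (M, n)) = (- 1) powi (2 * M + e - n) *
            q powi (tri (M + e - 2 * n) + 2 * tri (n + M) + (n + M)) * z powi (3 * M + e)"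
          by (simp add: \<phi>_def fnorm algebra_simps)
        have t: "2 * tri (M + e - 2 * n) = (M + e - 2 * n) * (M + e - 2 * n - 1)"
          "2 * tri (n + M) = (n + M) * (n + M - 1)" "2 * tri M = M * (M - 1)" "2 * tri n = n * (n - 1)"
          by (rule two_tri)+
        consider "e = 0" | "e = 1" | "e = 2" using e by auto
        thus ?thesis
        proof cases
          case e0: 1
          have ex: "tri (M + e - 2 * n) + 2 * tri (n + M) + (n + M) = 3 * tri M + int 1 * M + 6 * tri n + int 4 * n"
            using t e0 by (simp add: algebra_simps)
          show ?thesis
            using gnorm[of M 1 n 4] unfolding fe sgn ex by (simp add: e0 A_def B_def c_def)
        next
          case e1: 2
          have ex: "tri (M + e - 2 * n) + 2 * tri (n + M) + (n + M) = 3 * tri M + int 2 * M + 6 * tri n + int 2 * n"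
            using t e1 by (simp add: algebra_simps)
          show ?thesis
            using gnorm[of M 2 n 2] z unfolding fe sgn ex by (simp add: e1 A_def B_def c_def power_int_add mult_ac)
        next
          case e2: 3
          have ex0: "tri (M + e - 2 * n) + 2 * tri (n + M) + (n + M) = 1 + (3 * tri M + int 3 * M + 6 * tri n + int 0 * n)"
            using t e2 by (simp add: algebra_simps)
          have ex: "q powi (tri (M + e - 2 * n) + 2 * tri (n + M) + (n + M)) =
              q * q powi (3 * tri M + int 3 * M + 6 * tri n + int 0 * n)"
            unfolding ex0 using q by (subst power_int_add) auto
          show ?thesis
            using gnorm[of M 3 n 0] z unfolding fe sgn ex by (simp add: e2 A_def B_def c_def power_int_add mult_ac)
        qed
      qed
      show ?thesis
        unfolding S_def
      proof (rule has_sum_mult_prod)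
        show "((\<lambda>M. c e * ?F (q ^ 3) (A e) M) has_sum c e * (euler_phi (q ^ 3) * jtheta (A e) (q ^ 3))) UNIV"
          using nz by (intro has_sum_cmult_right jtp) auto
        show "(?F (q ^ 6) (B e) has_sum euler_phi (q ^ 6) * jtheta (B e) (q ^ 6)) UNIV"
          using nz by (intro jtp) auto
      qed (rule pt)
    qed
  qed auto
  ultimately have "(euler_phi q * jtheta z q) * (euler_phi (q ^ 2) * jtheta (q * z ^ 2) (q ^ 2)) = sum S {0, 1, 2}"
    using has_sum_unique by blast
  \<comment> \<open>The class of z-exponents congruent to 2 contains the theta function at its zero
    1.\<close>
  moreover have "S 2 = 0"
    using jtheta_1[OF qn[of 6]] by (simp add: S_def B_def)
  moreover have "euler_phi (q ^ 6) * jtheta (q ^ 4) (q ^ 6) = euler_phi (q ^ 2)"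
    "euler_phi (q ^ 6) * jtheta (q ^ 2) (q ^ 6) = euler_phi (q ^ 2)"
    using euler_phi_cubic[of "q ^ 2"] qn[of 2] q by (simp_all flip: power_mult)
  hence "S 0 = euler_phi (q ^ 3) * jtheta (- (q * z ^ 3)) (q ^ 3) * euler_phi (q ^ 2)"
    and "S 1 = - z * (euler_phi (q ^ 3) * jtheta (- (q ^ 2 * z ^ 3)) (q ^ 3)) * euler_phi (q ^ 2)"
    by (simp_all add: S_def A_def B_def c_def)
  ultimately have "euler_phi (q ^ 2) * (euler_phi q * jtheta z q * jtheta (q * z ^ 2) (q ^ 2)) =
      euler_phi (q ^ 2) * (euler_phi (q ^ 3) * (jtheta (- (q * z ^ 3)) (q ^ 3) - z * jtheta (- (q ^ 2 * z ^ 3)) (q ^ 3)))"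
    by (simp add: algebra_simps)
  thus ?thesis
    using euler_phi_nonzero[OF qn[of 2]] by simp
qed

text \<open>The triple product of nome x^3 at z = x is the pentagonal number series. Sorting its
  index modulo 5 gives theta functions of nome x^75. Class 1 is -x times
  \<open>euler_phi (x ^ 25)\<close>; the classes 0, 2 and the classes -1, 3 each combine by the
  quintuple product.\<close>

theorem euler_phi_dissection:
  fixes x :: complex
  assumes x: "norm x < 1" "x \<noteq> 0"
  defines "T1 \<equiv> jtheta (x ^ 5) (x ^ 25)" and "T2 \<equiv> jtheta (x ^ 10) (x ^ 25)"
  shows "euler_phi x * (T1 * T2) = euler_phi (x ^ 25) * (T2 ^ 2 - x * (T1 * T2) - x ^ 2 * T1 ^ 2)"
proof -
  let ?F = "\<lambda>q z k. q powi tri k * (- z) powi k"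
  have xn: "norm (x ^ n) < 1" if "n > 0" for n
    using x that by (simp add: norm_power power_less_one_iff)
  let ?G = "\<lambda>i. euler_phi (x ^ 75) * jtheta (x ^ i) (x ^ 75)"
  \<comment> \<open>At the index 5 M + e the exponent is that of \<open>c e\<close> plus 75
    \<open>tri M\<close> plus \<open>A e\<close> times M.\<close>
  define c where "c = (\<lambda>e::int. if e = 0 then 1 else if e = 1 then - x else if e = 2 then x ^ 5
      else if e = 3 then - (x ^ 12) else - (x ^ 2))"
  define A where "A = (\<lambda>e::int. if e = 0 then 35 else if e = 1 then 50 else if e = 2 then 65
      else if e = 3 then 80 else 20 :: nat)"
  have "(?F (x ^ 3) x has_sum euler_phi x) UNIV"
    using jacobi_triple_product[of "x ^ 3" x] xn[of 3] x euler_phi_cubic[of x] by simp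
  moreover have "(?F (x ^ 3) x has_sum (\<Sum>e\<in>{-1, 0, 1, 2, 3}. c e * ?G (A e))) UNIV"
  \<comment> \<open>The residues are represented by -1, ..., 3, hence the shift by one. With -1 in
    place of 4 the exponents 20 and 80 match, up to reflection, those of the quintuple
    product.\<close>
  proof (rule has_sum_partition[where \<phi> = "\<lambda>e M. 5 * M + e" and di = "\<lambda>n. (n + 1) mod 5 - 1"
        and dx = "\<lambda>n. (n + 1) div 5"])
    show "((5 * M + e + 1) mod 5 - 1, (5 * M + e + 1) div 5) = (e, M)"
      if "e \<in> {-1, 0, 1, 2, 3}" for e M :: int
      using that by auto
    show "(n + 1) mod 5 - 1 \<in> {-1, 0, 1, 2, 3} \<and> 5 * ((n + 1) div 5) + ((n + 1) mod 5 - 1) = n" for n :: int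
      by (auto; presburger)
    show "((\<lambda>M. ?F (x ^ 3) x (5 * M + e)) has_sum c e * ?G (A e)) UNIV" if e: "e \<in> {-1, 0, 1, 2, 3}" for e :: int
    proof -
      have "((\<lambda>M. c e * ?F (x ^ 75) (x ^ A e) M) has_sum c e * ?G (A e)) UNIV"
        using x xn[of 75] by (intro has_sum_cmult_right jacobi_triple_product) auto
      moreover have "?F (x ^ 3) x (5 * M + e) = c e * ?F (x ^ 75) (x ^ A e) M" for M
      proof -
        define d :: int where "d = (if e = 0 then 0 else if e = 1 then 1 else if e = 2 then 5
            else if e = 3 then 12 else 2)"
        have c: "c e = (- 1) powi e * x powi d"
          using e by (auto simp: c_def d_def)
        have "2 * (3 * tri (5 * M + e) + (5 * M + e)) = 2 * (d + 75 * tri M + int (A e) * M)"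
          using e two_tri[of "5 * M + e"] two_tri[of M] by (auto simp: d_def A_def algebra_simps)
        hence ex: "3 * tri (5 * M + e) + (5 * M + e) = d + 75 * tri M + int (A e) * M"
          by simp
        have "?F (x ^ 3) x (5 * M + e) = (- 1) powi (5 * M + e) * x powi (3 * tri (5 * M + e) + (5 * M + e))"
          using x by (simp add: minus_powi[of x] power_powi power_int_add mult_ac)
        also have "(- 1 :: complex) powi (5 * M + e) = (- 1) powi e * (- 1) powi M"
          using powi_sign_cong[of "5 * M + e" "e + M"] by (simp add: power_int_add)
        also have "x powi (3 * tri (5 * M + e) + (5 * M + e)) = x powi d * x powi (75 * tri M) * x powi (int (A e) * M)"
          unfolding ex using x by (simp add: power_int_add)
        finally show ?thesis
          unfolding c by (simp add: minus_powi[of "x ^ A e"] power_powi mult_ac)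
      qed
      ultimately show ?thesis by simp
    qed
  qed auto
  ultimately have "euler_phi x = (\<Sum>e\<in>{-1, 0, 1, 2, 3}. c e * ?G (A e))"
    using has_sum_unique by blast
  hence dis: "euler_phi x = (?G 35 + x ^ 5 * ?G 65) - x * ?G 50 - x ^ 2 * (?G 20 + x ^ 10 * ?G 80)"
    by (simp add: c_def A_def algebra_simps flip: power_add)
  have G50: "?G 50 = euler_phi (x ^ 25)"
    using euler_phi_cubic(2)[of "x ^ 25"] xn[of 25] x by (simp flip: power_mult)
  \<comment> \<open>Quintuple product of nome x^25 at z = -x^5; the second pair below uses z =
    -x^10.\<close>
  have "?G 35 + x ^ 5 * ?G 65 = euler_phi (x ^ 25) * jtheta (- (x ^ 5)) (x ^ 25) * jtheta (x ^ 35) (x ^ 50)"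
    using quintuple_product[of "x ^ 25" "- (x ^ 5)"] xn[of 25] x jtheta_reflect_power[of x 40 35 75]
    by (simp add: algebra_simps flip: power_mult power_add)
  \<comment> \<open>T1 times the theta function at -x^5 is the one at x^10 of nome x^50; together
    with that at x^35 it forms T2, by \<open>jtheta_split\<close>.\<close>
  moreover have "T1 * (jtheta (- (x ^ 5)) (x ^ 25) * jtheta (x ^ 35) (x ^ 50)) = T2"
    using jtheta_mult_minus[of "x ^ 25" "x ^ 5"] jtheta_split[of "x ^ 25" "x ^ 10"] xn[of 25] x
    by (simp add: T1_def T2_def algebra_simps flip: power_mult power_add)
  ultimately have 1: "T1 * (?G 35 + x ^ 5 * ?G 65) = euler_phi (x ^ 25) * T2"
    by (metis mult.assoc mult.left_commute)
  have "?G 20 + x ^ 10 * ?G 80 = euler_phi (x ^ 25) * jtheta (- (x ^ 10)) (x ^ 25) * jtheta (x ^ 45) (x ^ 50)"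
    using quintuple_product[of "x ^ 25" "- (x ^ 10)"] xn[of 25] x jtheta_reflect_power[of x 55 20 75]
    by (simp add: algebra_simps flip: power_mult power_add)
  moreover have "T2 * (jtheta (- (x ^ 10)) (x ^ 25) * jtheta (x ^ 45) (x ^ 50)) = T1"
    using jtheta_mult_minus[of "x ^ 25" "x ^ 10"] jtheta_split[of "x ^ 25" "x ^ 5"] xn[of 25] x
      jtheta_reflect_power[of x 45 5 50] jtheta_reflect_power[of x 30 20 50]
    by (simp add: T1_def T2_def algebra_simps flip: power_mult power_add)
  ultimately have 2: "T2 * (?G 20 + x ^ 10 * ?G 80) = euler_phi (x ^ 25) * T1"
    by (metis mult.assoc mult.left_commute)
  have "euler_phi x * (T1 * T2) = (T1 * (?G 35 + x ^ 5 * ?G 65)) * T2 - x * ?G 50 * (T1 * T2)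
      - x ^ 2 * (T2 * (?G 20 + x ^ 10 * ?G 80)) * T1"
    unfolding dis by (simp add: algebra_simps)
  thus ?thesis
    unfolding 1 2 G50 by (simp add: algebra_simps power2_eq_square)
qed

section \<open>Products over fifth roots of unity\<close>

text \<open>The factors with w, w^4 and those with w^2, w^3 are paired. The middle coefficients
  \<alpha> and \<beta> of the resulting quadratics have sum and product -1.\<close>

lemma prod_fifth_roots:
  fixes w u v :: complex
  assumes "1 + w + w ^ 2 + w ^ 3 + w ^ 4 = 0"
  shows "(u - v) * (u - w * v) * (u - w ^ 2 * v) * (u - w ^ 3 * v) * (u - w ^ 4 * v) = u ^ 5 - v ^ 5"
proof -
  define \<alpha> where "\<alpha> = w + w ^ 4"
  define \<beta> where "\<beta> = w ^ 2 + w ^ 3"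
  have w5: "w ^ 5 = 1" using assms by algebra
  have s: "\<alpha> + \<beta> = - 1" using assms unfolding \<alpha>_def \<beta>_def by algebra
  have p: "\<alpha> * \<beta> = - 1" using assms unfolding \<alpha>_def \<beta>_def by algebra
  have 1: "(u - w * v) * (u - w ^ 4 * v) = u ^ 2 - \<alpha> * (u * v) + v ^ 2"
    using w5 unfolding \<alpha>_def by algebra
  have 2: "(u - w ^ 2 * v) * (u - w ^ 3 * v) = u ^ 2 - \<beta> * (u * v) + v ^ 2"
    using w5 unfolding \<beta>_def by algebra
  have "(u - v) * (u - w * v) * (u - w ^ 2 * v) * (u - w ^ 3 * v) * (u - w ^ 4 * v) =
      (u - v) * ((u - w * v) * (u - w ^ 4 * v)) * ((u - w ^ 2 * v) * (u - w ^ 3 * v))"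
    by (simp add: mult_ac)
  also have "\<dots> = u ^ 5 - v ^ 5"
    unfolding 1 2 using s p by algebra
  finally show ?thesis .
qed

lemma qpoch_prod_fifth_roots:
  fixes w q z :: complex
  assumes w: "1 + w + w ^ 2 + w ^ 3 + w ^ 4 = 0" and q: "norm q < 1"
  shows "qpoch z q * qpoch (w * z) q * qpoch (w ^ 2 * z) q * qpoch (w ^ 3 * z) q * qpoch (w ^ 4 * z) q =
    qpoch (z ^ 5) (q ^ 5)"
proof (rule qpoch_eqI[symmetric])
  show "norm (q ^ 5) < 1"
    using q by (simp add: norm_power power_less_one_iff)
  have "1 - z ^ 5 * (q ^ 5) ^ n = (1 - z * q ^ n) * (1 - w * z * q ^ n) * (1 - w ^ 2 * z * q ^ n) *
      (1 - w ^ 3 * z * q ^ n) * (1 - w ^ 4 * z * q ^ n)" for n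
  proof -
    have "(q ^ 5) ^ n = (q ^ n) ^ 5" by (simp flip: power_mult add: mult.commute)
    thus ?thesis
      using prod_fifth_roots[OF w, of 1 "z * q ^ n"] by (simp add: power_mult_distrib mult.assoc)
  qed
  hence "(\<Prod>n<m. 1 - z ^ 5 * (q ^ 5) ^ n) = (\<Prod>n<m. 1 - z * q ^ n) * (\<Prod>n<m. 1 - w * z * q ^ n) *
     (\<Prod>n<m. 1 - w ^ 2 * z * q ^ n) * (\<Prod>n<m. 1 - w ^ 3 * z * q ^ n) * (\<Prod>n<m. 1 - w ^ 4 * z * q ^ n)" for m
    by (simp add: prod.distrib)
  thus "(\<lambda>m. \<Prod>n<m. 1 - z ^ 5 * (q ^ 5) ^ n) \<longlonglongrightarrow>
      qpoch z q * qpoch (w * z) q * qpoch (w ^ 2 * z) q * qpoch (w ^ 3 * z) q * qpoch (w ^ 4 * z) q"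
    using q by (auto intro!: tendsto_intros qpoch_LIMSEQ)
qed

text \<open>Each \<open>euler_phi (w ^ j * x)\<close> is split by exponents modulo 5. The multiples
  of 5 contribute \<open>euler_phi (x ^ 5)\<close> five times. Each other class, multiplied over j,
  becomes one class of \<open>euler_phi (x ^ 5)\<close>; with \<open>euler_phi (x ^ 25)\<close>
  these make up the sixth factor.\<close>

lemma euler_phi_prod_fifth_roots:
  fixes w x :: complex
  assumes w: "1 + w + w ^ 2 + w ^ 3 + w ^ 4 = 0" and x: "norm x < 1"
  shows "euler_phi (x ^ 25) *
      (euler_phi x * euler_phi (w * x) * euler_phi (w ^ 2 * x) * euler_phi (w ^ 3 * x) * euler_phi (w ^ 4 * x)) =
    euler_phi (x ^ 5) ^ 6"
proof -
  have w5: "w ^ 5 = 1" using w by algebra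
  have x5: "norm (x ^ 5) < 1"
    using x by (simp add: norm_power power_less_one_iff)
  have split: "euler_phi y = qpoch y (y ^ 5) * qpoch (y ^ 2) (y ^ 5) * qpoch (y ^ 3) (y ^ 5) *
      qpoch (y ^ 4) (y ^ 5) * euler_phi (y ^ 5)" if "norm y < 1" for y
    using qpoch_split[OF that, of 5 y] by (simp add: euler_phi_def eval_nat_numeral lessThan_Suc mult_ac)
  have nw: "norm w = 1"
    using w5 by (metis norm_ge_zero norm_one norm_power power_eq_1_iff zero_neq_numeral)
  have E: "euler_phi (w ^ j * x) = qpoch (w ^ j * x) (x ^ 5) * qpoch (w ^ (2 * j) * x ^ 2) (x ^ 5) *
      qpoch (w ^ (3 * j) * x ^ 3) (x ^ 5) * qpoch (w ^ (4 * j) * x ^ 4) (x ^ 5) * euler_phi (x ^ 5)" for j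
  proof -
    have pw: "(w ^ j * x) ^ 5 = x ^ 5"
      using w5 by (metis mult.commute mult_1 power_mult power_mult_distrib power_one)
    have "norm (w ^ j * x) < 1"
      using x nw by (simp add: norm_mult norm_power)
    from split[OF this, unfolded pw] show ?thesis
      by (simp add: power_mult_distrib mult.commute flip: power_mult)
  qed
  have w2: "1 + w ^ 2 + (w ^ 2) ^ 2 + (w ^ 2) ^ 3 + (w ^ 2) ^ 4 = 0"
    and w3: "1 + w ^ 3 + (w ^ 3) ^ 2 + (w ^ 3) ^ 3 + (w ^ 3) ^ 4 = 0"
    and w4: "1 + w ^ 4 + (w ^ 4) ^ 2 + (w ^ 4) ^ 3 + (w ^ 4) ^ 4 = 0"
    using w by algebra+
  let ?e = "euler_phi (x ^ 5)" and ?p = "\<lambda>z. qpoch z (x ^ 5)"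
  have P1: "qpoch (x ^ 5) (x ^ 25) = ?p (x) * ?p (w * x) * ?p (w ^ 2 * x) * ?p (w ^ 3 * x) * ?p (w ^ 4 * x)"
    using qpoch_prod_fifth_roots[OF w x5, of x] by (simp flip: power_mult)
  \<comment> \<open>The powers of w are left unreduced so that the factors agree literally with
    those of \<open>E0\<close> to \<open>E4\<close>.\<close>
  have P2: "qpoch (x ^ 10) (x ^ 25) = ?p (x ^ 2) * ?p (w ^ 2 * x ^ 2) * ?p (w ^ 4 * x ^ 2) * ?p (w ^ 6 * x ^ 2) * ?p (w ^ 8 * x ^ 2)"
    using qpoch_prod_fifth_roots[OF w2 x5, of "x ^ 2"] by (simp flip: power_mult)
  have P3: "qpoch (x ^ 15) (x ^ 25) = ?p (x ^ 3) * ?p (w ^ 3 * x ^ 3) * ?p (w ^ 6 * x ^ 3) * ?p (w ^ 9 * x ^ 3) * ?p (w ^ 12 * x ^ 3)"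
    using qpoch_prod_fifth_roots[OF w3 x5, of "x ^ 3"] by (simp flip: power_mult)
  have P4: "qpoch (x ^ 20) (x ^ 25) = ?p (x ^ 4) * ?p (w ^ 4 * x ^ 4) * ?p (w ^ 8 * x ^ 4) * ?p (w ^ 12 * x ^ 4) * ?p (w ^ 16 * x ^ 4)"
    using qpoch_prod_fifth_roots[OF w4 x5, of "x ^ 4"] by (simp flip: power_mult)
  have E0: "euler_phi x = ?p (x) * ?p (x ^ 2) * ?p (x ^ 3) * ?p (x ^ 4) * ?e"
    using E[of 0] by simp
  have E1: "euler_phi (w * x) = ?p (w * x) * ?p (w ^ 2 * x ^ 2) * ?p (w ^ 3 * x ^ 3) * ?p (w ^ 4 * x ^ 4) * ?e"
    using E[of 1] by simp
  have E2: "euler_phi (w ^ 2 * x) = ?p (w ^ 2 * x) * ?p (w ^ 4 * x ^ 2) * ?p (w ^ 6 * x ^ 3) * ?p (w ^ 8 * x ^ 4) * ?e"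
    using E[of 2] by simp
  have E3: "euler_phi (w ^ 3 * x) = ?p (w ^ 3 * x) * ?p (w ^ 6 * x ^ 2) * ?p (w ^ 9 * x ^ 3) * ?p (w ^ 12 * x ^ 4) * ?e"
    using E[of 3] by simp
  have E4: "euler_phi (w ^ 4 * x) = ?p (w ^ 4 * x) * ?p (w ^ 8 * x ^ 2) * ?p (w ^ 12 * x ^ 3) * ?p (w ^ 16 * x ^ 4) * ?e"
    using E[of 4] by simp
  have "euler_phi x * euler_phi (w * x) * euler_phi (w ^ 2 * x) * euler_phi (w ^ 3 * x) * euler_phi (w ^ 4 * x) =
     qpoch (x ^ 5) (x ^ 25) * qpoch (x ^ 10) (x ^ 25) * qpoch (x ^ 15) (x ^ 25) * qpoch (x ^ 20) (x ^ 25) *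
       (?e * ?e * ?e * ?e * ?e)"
    unfolding P1 P2 P3 P4 E0 E1 E2 E3 E4 by (simp only: mult_ac)
  moreover have "?e = qpoch (x ^ 5) (x ^ 25) * qpoch (x ^ 10) (x ^ 25) * qpoch (x ^ 15) (x ^ 25) *
      qpoch (x ^ 20) (x ^ 25) * euler_phi (x ^ 25)"
    using split[OF x5] by (simp flip: power_mult)
  ultimately show ?thesis
    by (simp add: mult_ac power_numeral_reduce)
qed

lemma exists_primitive_fifth_root: "\<exists>w::complex. 1 + w + w ^ 2 + w ^ 3 + w ^ 4 = 0"
proof -
  define w :: complex where "w = cis (2 * pi / 5)"
  have "w ^ 5 = 1" unfolding w_def Complex.DeMoivre by simp
  hence "(w - 1) * (1 + w + w ^ 2 + w ^ 3 + w ^ 4) = 0" by algebra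
  moreover have "w \<noteq> 1"
  proof
    assume "w = 1"
    hence "cos (2 * pi / 5) = 1" by (simp add: w_def complex_eq_iff)
    moreover have "cos (2 * pi / 5) < cos 0"
      by (rule cos_monotone_0_pi) auto
    ultimately show False by simp
  qed
  ultimately show ?thesis by auto
qed

text \<open>The coefficient 11 is the fifth Lucas number: the quadratic form splits over the golden
  ratio.\<close>

lemma prod_fifth_roots_quadratic:
  fixes w A B :: complex
  assumes w: "1 + w + w ^ 2 + w ^ 3 + w ^ 4 = 0"
  defines "Q \<equiv> \<lambda>t. A ^ 2 - t * (A * B) - t ^ 2 * B ^ 2"
  shows "Q 1 * Q w * Q (w ^ 2) * Q (w ^ 3) * Q (w ^ 4) = A ^ 10 - 11 * (A * B) ^ 5 - B ^ 10"
proof -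
  obtain r :: complex where r: "r ^ 2 = 5"
    using power2_csqrt by blast
  define g :: complex where "g = (1 + r) / 2"
  define g' :: complex where "g' = 1 - g"
  have g: "g ^ 2 = g + 1"
    unfolding g_def using r by (simp add: field_simps power2_eq_square)
  have gg: "g * g' = - 1" unfolding g'_def using g by algebra
  have Q: "Q t = (A - t * (g * B)) * (A - t * (g' * B))" for t
    unfolding Q_def g'_def using g by algebra
  have "Q 1 * Q w * Q (w ^ 2) * Q (w ^ 3) * Q (w ^ 4) =
     ((A - g * B) * (A - w * (g * B)) * (A - w ^ 2 * (g * B)) * (A - w ^ 3 * (g * B)) * (A - w ^ 4 * (g * B))) *
     ((A - g' * B) * (A - w * (g' * B)) * (A - w ^ 2 * (g' * B)) * (A - w ^ 3 * (g' * B)) * (A - w ^ 4 * (g' * B)))"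
    unfolding Q by (simp add: mult_ac)
  also have "\<dots> = (A ^ 5 - (g * B) ^ 5) * (A ^ 5 - (g' * B) ^ 5)"
    unfolding prod_fifth_roots[OF w] ..
  also have "\<dots> = A ^ 10 - (g ^ 5 + g' ^ 5) * (A * B) ^ 5 + (g * g') ^ 5 * B ^ 10"
    by (simp add: algebra_simps power_mult_distrib flip: power_add)
  also have "g ^ 5 + g' ^ 5 = 11"
    unfolding g'_def using g by algebra
  finally show ?thesis using gg by simp
qed

text \<open>The dissection is multiplied over x, w x, ..., w^4 x. T1 and T2 depend on x^5 only, so
  they do not change, and the right sides form a product of quadratic forms in T2 and x T1.\<close>

theorem euler_phi_sixth_power:
  fixes x :: complex
  assumes x: "norm x < 1" "x \<noteq> 0"
  defines "T1 \<equiv> jtheta (x ^ 5) (x ^ 25)" and "T2 \<equiv> jtheta (x ^ 10) (x ^ 25)"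
  shows "euler_phi (x ^ 5) ^ 6 * (T1 * T2) ^ 5 =
    euler_phi (x ^ 25) ^ 6 * (T2 ^ 10 - 11 * (x * (T1 * T2)) ^ 5 - (x * T1) ^ 10)"
proof -
  obtain w :: complex where w: "1 + w + w ^ 2 + w ^ 3 + w ^ 4 = 0"
    using exists_primitive_fifth_root by blast
  have w5: "w ^ 5 = 1" using w by algebra
  have nw: "norm w = 1"
    using w5 by (metis norm_ge_zero norm_one norm_power power_eq_1_iff zero_neq_numeral)
  have w0: "w \<noteq> 0" using w5 by auto
  let ?e = "euler_phi (x ^ 25)"
  define Q where "Q = (\<lambda>t. T2 ^ 2 - t * (T2 * (x * T1)) - t ^ 2 * (x * T1) ^ 2)"
  have D: "euler_phi (t * x) * (T1 * T2) = ?e * Q t" if "t ^ 5 = 1" "norm t = 1" for t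
  proof -
    have "(t * x) ^ 5 = x ^ 5" "(t * x) ^ 10 = x ^ 10" "(t * x) ^ 25 = x ^ 25"
      using that power_mult[of t 5 2] power_mult[of t 5 5] by (simp_all add: power_mult_distrib)
    moreover have "t \<noteq> 0" using that by auto
    ultimately show ?thesis
      using euler_phi_dissection[of "t * x"] x that
      by (simp add: norm_mult T1_def T2_def Q_def power_mult_distrib mult_ac)
  qed
  have wj: "(w ^ j) ^ 5 = 1" "norm (w ^ j) = 1" for j
    using w5 nw by (simp_all add: norm_power flip: power_mult) (simp add: power_mult mult.commute[of j])
  have "euler_phi (x ^ 5) ^ 6 * (T1 * T2) ^ 5 = ?e * ((euler_phi (1 * x) * (T1 * T2)) * (euler_phi (w * x) * (T1 * T2)) *
      (euler_phi (w ^ 2 * x) * (T1 * T2)) * (euler_phi (w ^ 3 * x) * (T1 * T2)) * (euler_phi (w ^ 4 * x) * (T1 * T2)))"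
    unfolding euler_phi_prod_fifth_roots[OF w x(1), symmetric] by (simp add: algebra_simps eval_nat_numeral)
  also have "\<dots> = ?e * ((?e * Q 1) * (?e * Q w) * (?e * Q (w ^ 2)) * (?e * Q (w ^ 3)) * (?e * Q (w ^ 4)))"
    using D[of 1] D[OF wj, of 1] D[OF wj, of 2] D[OF wj, of 3] D[OF wj, of 4] by simp
  also have "\<dots> = ?e ^ 6 * (Q 1 * Q w * Q (w ^ 2) * Q (w ^ 3) * Q (w ^ 4))"
    by (simp add: mult_ac eval_nat_numeral)
  also have "Q 1 * Q w * Q (w ^ 2) * Q (w ^ 3) * Q (w ^ 4) = T2 ^ 10 - 11 * (T2 * (x * T1)) ^ 5 - (x * T1) ^ 10"
    unfolding Q_def by (rule prod_fifth_roots_quadratic[OF w])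
  finally show ?thesis by (simp add: mult_ac)
qed

section \<open>Theta functions of level ten\<close>

lemma qpoch_power_split:
  assumes "norm q < 1" "0 < k" "0 < m"
  shows "qpoch (q ^ i) (q ^ k) = (\<Prod>j<m. qpoch (q ^ (i + k * j)) (q ^ (k * m)))"
  using qpoch_split[of "q ^ k" m "q ^ i"] assms
  by (simp add: norm_power power_less_one_iff power_add power_mult)

text \<open>The first two relations are instances of the three-term relation of nome q^10 at
  half-integral powers of q. The other two sort the exponents of the Euler products modulo
  10.\<close>

lemma level_ten_theta:
  fixes q :: complex
  assumes q: "norm q < 1" "q \<noteq> 0"
  defines "t \<equiv> \<lambda>i::nat. jtheta (q ^ i) (q ^ 10)"
  shows "t 1 * t 4 * (t 3 * t 4 + q * (t 1 * t 2)) = t 2 ^ 2 * t 3 * t 5"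
    and "t 2 * t 3 * (t 3 * t 4 - q * (t 1 * t 2)) = t 4 ^ 2 * t 1 * t 5"
    and "t 1 * t 3 * (euler_phi (q ^ 5) * euler_phi (q ^ 2)) = euler_phi q * euler_phi (q ^ 10)"
    and "t 5 * euler_phi (q ^ 10) ^ 2 = euler_phi (q ^ 5) ^ 2"
proof -
  have q10: "norm (q ^ 10) < 1" "q ^ 10 \<noteq> 0"
    using q by (auto simp: norm_power power_less_one_iff)
  \<comment> \<open>All arguments will be odd powers of s, so that their products and quotients are
    integral powers of q. Either square root would do.\<close>
  define s where "s = csqrt q"
  have s: "s ^ 2 = q" "s \<noteq> 0" using q by (auto simp: s_def)
  have refl: "jtheta (q ^ 6) (q ^ 10) = t 4" "jtheta (q ^ 7) (q ^ 10) = t 3" "jtheta (q ^ 8) (q ^ 10) = t 2"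
    unfolding t_def by (rule jtheta_reflect_power; use q in simp)+
  have inv: "jtheta (1 / q ^ i) (q ^ 10) = - t i / q ^ i" for i
    unfolding t_def using q by (intro jtheta_inverse q10) auto
  have sp: "s ^ (2 * n) = q ^ n" for n
    using s by (simp add: power_mult)
  have sdiv: "s ^ j / s ^ i = q ^ ((j - i) div 2)" if "i \<le> j" "even (i + j)" for i j
    using that s sp[of "(j - i) div 2"] by (simp add: power_diff)
  define W where "W = (\<lambda>a b. jtheta (a * b) (q ^ 10) * jtheta (a / b) (q ^ 10))"
  have Wpp: "W (s ^ i) (s ^ j) = jtheta (q ^ ((i + j) div 2)) (q ^ 10) * jtheta (q ^ ((i - j) div 2)) (q ^ 10)"
    if "j \<le> i" "even (i + j)" for i j
  proof -
    have "s ^ i * s ^ j = q ^ ((i + j) div 2)"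
      using that sp[of "(i + j) div 2"] by (simp add: power_add)
    moreover have "s ^ i / s ^ j = q ^ ((i - j) div 2)"
      using that by (simp add: sdiv)
    ultimately show ?thesis by (simp add: W_def)
  qed
  have Wpm: "W (s ^ i) (1 / s ^ j) = jtheta (q ^ ((i - j) div 2)) (q ^ 10) * jtheta (q ^ ((i + j) div 2)) (q ^ 10)"
    if "j \<le> i" "even (i + j)" for i j
    using Wpp[OF that] by (simp add: W_def mult.commute)
  have Wpm': "W (s ^ i) (1 / s ^ j) = jtheta (1 / q ^ ((j - i) div 2)) (q ^ 10) * jtheta (q ^ ((i + j) div 2)) (q ^ 10)"
    if "i \<le> j" "even (i + j)" for i j
  proof -
    have "s ^ i * (1 / s ^ j) = 1 / q ^ ((j - i) div 2)"
      using that by (simp flip: sdiv)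
    moreover have "s ^ i / (1 / s ^ j) = q ^ ((i + j) div 2)"
      using that sp[of "(i + j) div 2"] by (simp add: power_add)
    ultimately show ?thesis by (simp add: W_def)
  qed
  have Wpp': "W (s ^ i) (s ^ j) = jtheta (q ^ ((i + j) div 2)) (q ^ 10) * jtheta (1 / q ^ ((j - i) div 2)) (q ^ 10)"
    if "i \<le> j" "even (i + j)" for i j
    using Wpm'[OF that] by (simp add: W_def mult.commute)
  have Wmp: "W (1 / s ^ i) (s ^ j) = jtheta (1 / q ^ ((i - j) div 2)) (q ^ 10) * jtheta (1 / q ^ ((i + j) div 2)) (q ^ 10)"
    if "j \<le> i" "even (i + j)" for i j
  proof -
    have "1 / s ^ i * s ^ j = 1 / q ^ ((i - j) div 2)"
      using that by (simp flip: sdiv)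
    moreover have "1 / s ^ i / s ^ j = 1 / q ^ ((i + j) div 2)"
      using that sp[of "(i + j) div 2"] by (simp add: power_add)
    ultimately show ?thesis by (simp add: W_def)
  qed
  have Wmm: "W (1 / s ^ i) (1 / s ^ j) = jtheta (1 / q ^ ((i + j) div 2)) (q ^ 10) * jtheta (q ^ ((j - i) div 2)) (q ^ 10)"
    if "i \<le> j" "even (i + j)" for i j
  proof -
    have "1 / s ^ i * (1 / s ^ j) = 1 / q ^ ((i + j) div 2)"
      using that sp[of "(i + j) div 2"] by (simp add: power_add)
    moreover have "1 / s ^ i / (1 / s ^ j) = q ^ ((j - i) div 2)"
      using that by (simp add: sdiv)
    ultimately show ?thesis unfolding W_def by metis
  qed
  have wei: "y * (W x y * W u v) + u * (W x v * W y u) = u * (W x u * W y v)"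
    if "x \<noteq> 0" "y \<noteq> 0" "u \<noteq> 0" "v \<noteq> 0" for x y u v
    using weierstrass_three_term[OF q10 that] unfolding W_def .
  have inv1: "jtheta (1 / q) (q ^ 10) = - t 1 / q"
    using inv[of 1] by simp
  have s3: "s ^ 3 = s * q"
    using s(1) by (simp add: power2_eq_square power3_eq_cube mult_ac)
  \<comment> \<open>The three-term relation at x = s^7, y = s, u = s^3, v = s^(-5); these arguments
    produce exactly the wanted products of the \<open>t i\<close>.\<close>
  have "W (s ^ 7) s = t 4 * t 3" "W (s ^ 3) (1 / s ^ 5) = - t 1 / q * t 4"
    "W (s ^ 7) (1 / s ^ 5) = t 1 * t 4" "W s (s ^ 3) = t 2 * (- t 1 / q)"
    "W (s ^ 7) (s ^ 3) = t 5 * t 2" and W15: "W s (1 / s ^ 5) = - t 2 / q ^ 2 * t 3"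
    using Wpp[of 1 7] Wpm'[of 3 5] Wpm[of 5 7] Wpp'[of 1 3] Wpp[of 3 7] Wpm'[of 1 5] refl inv[of 2] inv1
    by (simp_all add: t_def)
  hence "s * (t 4 * t 3 * (- t 1 / q * t 4)) + s ^ 3 * (t 1 * t 4 * (t 2 * (- t 1 / q))) =
      s ^ 3 * (t 5 * t 2 * (- t 2 / q ^ 2 * t 3))"
    using wei[of "s ^ 7" s "s ^ 3" "1 / s ^ 5"] s(2) by simp
  hence "s * q * (t 1 * t 4 * (t 3 * t 4 + q * (t 1 * t 2))) = s * q * (t 2 ^ 2 * t 3 * t 5)"
    unfolding s3 using q by (simp add: field_simps power2_eq_square)
  thus "t 1 * t 4 * (t 3 * t 4 + q * (t 1 * t 2)) = t 2 ^ 2 * t 3 * t 5"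
    using s(2) q by simp
  have s3': "1 / s ^ 3 = s / q ^ 2"
    unfolding s(1)[symmetric] using s(2) by (simp add: field_simps eval_nat_numeral)
  \<comment> \<open>The second relation comes from x = s^11, y = s^(-3), u = s, v = s^(-5).\<close>
  have "W (s ^ 11) (1 / s ^ 3) = t 4 * t 3"
    "W (s ^ 11) (1 / s ^ 5) = t 3 * t 2" "W (1 / s ^ 3) s = - t 1 / q * (- t 2 / q ^ 2)"
    "W (s ^ 11) s = t 4 * t 5" "W (1 / s ^ 3) (1 / s ^ 5) = - t 4 / q ^ 4 * t 1"
    using Wpm[of 3 11] Wpm[of 5 11] Wmp[of 1 3] Wpp[of 1 11] Wmm[of 3 5] refl inv[of 2] inv[of 4] inv1
    by (simp_all add: t_def)
  hence "1 / s ^ 3 * (t 4 * t 3 * (- t 2 / q ^ 2 * t 3)) + s * (t 3 * t 2 * (- t 1 / q * (- t 2 / q ^ 2))) =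
      s * (t 4 * t 5 * (- t 4 / q ^ 4 * t 1))"
    using wei[of "s ^ 11" "1 / s ^ 3" s "1 / s ^ 5"] W15 s(2) by simp
  hence "s * q ^ 4 * (t 2 * t 3 * (t 3 * t 4 - q * (t 1 * t 2))) = s * q ^ 4 * (t 4 ^ 2 * t 1 * t 5)"
    unfolding s3' using q by (simp add: field_simps eval_nat_numeral)
  thus "t 2 * t 3 * (t 3 * t 4 - q * (t 1 * t 2)) = t 4 ^ 2 * t 1 * t 5"
    using s(2) q by simp
  have td: "t i = qpoch (q ^ i) (q ^ 10) * qpoch (q ^ (10 - i)) (q ^ 10)" if "i \<le> 10" for i
  proof -
    have "q ^ 10 / q ^ i = q ^ (10 - i)" using q that by (simp add: power_diff)
    thus ?thesis by (simp add: t_def jtheta_def)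
  qed
  let ?p = "\<lambda>i. qpoch (q ^ i) (q ^ 10)"
  have E2: "euler_phi (q ^ 2) = ?p 2 * ?p 4 * ?p 6 * ?p 8 * euler_phi (q ^ 10)"
    using qpoch_power_split[OF q(1), of 2 5 2]
    by (simp add: euler_phi_def lessThan_nat_numeral mult_ac del: power_Suc flip: numeral_2_eq_2)
  have E5: "euler_phi (q ^ 5) = ?p 5 * euler_phi (q ^ 10)"
    using qpoch_power_split[OF q(1), of 5 2 5]
    by (simp add: euler_phi_def lessThan_nat_numeral mult_ac del: power_Suc flip: numeral_2_eq_2)
  thus "t 5 * euler_phi (q ^ 10) ^ 2 = euler_phi (q ^ 5) ^ 2"
    by (simp add: td power2_eq_square mult_ac)
  have "euler_phi q = ?p 1 * ?p 2 * ?p 3 * ?p 4 * ?p 5 * ?p 6 * ?p 7 * ?p 8 * ?p 9 * euler_phi (q ^ 10)"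
    using qpoch_power_split[OF q(1), of 1 10 1]
    by (simp add: euler_phi_def lessThan_nat_numeral mult_ac del: power_Suc flip: numeral_2_eq_2)
  thus "t 1 * t 3 * (euler_phi (q ^ 5) * euler_phi (q ^ 2)) = euler_phi q * euler_phi (q ^ 10)"
    unfolding E2 E5 by (simp add: td mult_ac)
qed

section \<open>The modular equation\<close>

text \<open>With \<open>a = r(5\<tau>)\<close> and \<open>Y = l(5\<tau>)\<close>, the quotient \<open>N / D\<close> below equals \<open>l(\<tau>)\<close>; it was found by
  comparing expansions in powers of the nome.\<close>

lemma resolvent_quintic:
  fixes a Y N D :: complex
  assumes "a ^ 5 * Y ^ 2 * (Y + 1) = Y - 1"
  defines "N \<equiv> 1 + 2 * a + Y * a ^ 2 + Y * a ^ 4" and "D \<equiv> 1 + a ^ 2 + 2 * Y * a ^ 3 - Y * a ^ 4"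
  shows "(N ^ 5 - Y * D ^ 5) * (Y ^ 2 - Y - 1) ^ 2 =
    - 5 * N * Y * ((Y ^ 2 - Y - 1) * Y * N ^ 3 * D + (3 * Y ^ 2 + 2 * Y - 3) * N ^ 2 * D ^ 2
      - (3 * Y ^ 2 + 2 * Y - 3) * Y * N * D ^ 3 - (Y ^ 2 - Y - 1) * D ^ 4)"
  using assms(1) unfolding N_def D_def by algebra

text \<open>Says that X = N / D solves the equation of \<open>ell_quadratic\<close>. That equation
  prescribes X - 1/X, so its other root is -D / N. As for the quintic, the two sides differ by a
  multiple of the relation between a and Y.\<close>

lemma resolvent_quadratic:
  fixes a Y N D :: complex
  assumes "a ^ 5 * Y ^ 2 * (Y + 1) = Y - 1"
  defines "N \<equiv> 1 + 2 * a + Y * a ^ 2 + Y * a ^ 4" and "D \<equiv> 1 + a ^ 2 + 2 * Y * a ^ 3 - Y * a ^ 4"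
    and "b \<equiv> Y * a ^ 2"
  shows "(N ^ 2 - D ^ 2) * (1 - b - b ^ 2) * (1 + Y - Y ^ 2) =
    N * D * (1 - a - a ^ 2) * Y * a * (Y ^ 2 + 4 * Y - 1)"
  using assms(1) unfolding N_def D_def b_def by algebra

section \<open>Holomorphy in the nome\<close>

lemma holomorphic_qpoch_power:
  assumes "0 < k"
  shows "(\<lambda>q. qpoch (q ^ i) (q ^ k)) holomorphic_on ball 0 1"
proof (rule holomorphic_uniform_sequence)
  show "(\<lambda>q. \<Prod>m<n. 1 - q ^ i * (q ^ k) ^ m) holomorphic_on ball 0 1" for n
    by (intro holomorphic_intros)
  fix x :: complex
  assume x: "x \<in> ball 0 1"
  \<comment> \<open>Half the distance from x to the unit circle; \<open>\<rho>\<close> bounds the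
    modulus on the closed disc of radius d. As i + k n \<ge> n, factor n differs from 1 by at most
    \<open>\<rho> ^ n\<close> there.\<close>
  define d where "d = (1 - norm x) / 2"
  define \<rho> where "\<rho> = (1 + norm x) / 2"
  have d: "d > 0" and \<rho>: "0 \<le> \<rho>" "\<rho> < 1" using x by (auto simp: d_def \<rho>_def)
  have le: "norm q \<le> \<rho>" if "q \<in> cball x d" for q
  proof -
    have "norm q \<le> norm x + dist x q"
      by (metis add.commute dist_commute dist_norm norm_triangle_sub)
    also have "\<dots> \<le> norm x + d" using that by simp
    finally show ?thesis by (simp add: d_def \<rho>_def field_simps)
  qed
  have sub: "cball x d \<subseteq> ball 0 1"
    using le \<rho> by fastforce
  have "uniformly_convergent_on (cball x d) (\<lambda>N q. \<Prod>m<N. 1 - q ^ i * (q ^ k) ^ m)"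
  proof (rule uniformly_convergent_on_prod')
    show "uniformly_convergent_on (cball x d) (\<lambda>N q. \<Sum>n<N. norm (1 - q ^ i * (q ^ k) ^ n - 1))"
    proof (rule Weierstrass_m_test')
      show "summable (\<lambda>n. \<rho> ^ n)" using \<rho> by (simp add: summable_geometric)
      fix n q assume q: "q \<in> cball x d"
      have "norm (q ^ i * (q ^ k) ^ n) = norm q ^ (i + k * n)"
        by (simp add: norm_mult norm_power power_add power_mult)
      also have "\<dots> \<le> norm q ^ n"
        using assms le[OF q] \<rho> by (intro power_decreasing) (auto intro: trans_le_add2)
      also have "\<dots> \<le> \<rho> ^ n"
        using le[OF q] by (intro power_mono) auto
      finally show "norm (norm (1 - q ^ i * (q ^ k) ^ n - 1)) \<le> \<rho> ^ n"
        by simp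
    qed
  qed (auto intro!: continuous_intros)
  then obtain l where l: "uniform_limit (cball x d) (\<lambda>N q. \<Prod>m<N. 1 - q ^ i * (q ^ k) ^ m) l sequentially"
    by (auto simp: uniformly_convergent_on_def)
  have "l q = qpoch (q ^ i) (q ^ k)" if "q \<in> cball x d" for q
  proof (rule LIMSEQ_unique[OF tendsto_uniform_limitI[OF l that] qpoch_LIMSEQ])
    show "norm (q ^ k) < 1"
      using that sub assms by (auto simp: norm_power power_less_one_iff)
  qed
  with l have "uniform_limit (cball x d) (\<lambda>N q. \<Prod>m<N. 1 - q ^ i * (q ^ k) ^ m) (\<lambda>q. qpoch (q ^ i) (q ^ k)) sequentially"
    by (subst uniform_limit_cong'[where g = "\<lambda>N q. \<Prod>m<N. 1 - q ^ i * (q ^ k) ^ m" and i = l]) auto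
  thus "\<exists>d>0. cball x d \<subseteq> ball 0 1 \<and>
      uniform_limit (cball x d) (\<lambda>N q. \<Prod>m<N. 1 - q ^ i * (q ^ k) ^ m) (\<lambda>q. qpoch (q ^ i) (q ^ k)) sequentially"
    using d sub by blast
qed simp

text \<open>Written with \<open>qpoch\<close> rather than \<open>jtheta\<close>, these are holomorphic at 0 as well. They are
  \<open>r(2\<tau>) / r(\<tau>)\<^sup>2\<close> and \<open>r(5\<tau>)\<close> as functions of the nome.\<close>

definition ell :: "complex \<Rightarrow> complex" where
  "ell q = (let p = \<lambda>i. qpoch (q ^ i) (q ^ 10) in
     (p 2 * p 8) ^ 3 * (p 3 * p 7) ^ 2 / ((p 1 * p 9) ^ 2 * (p 4 * p 6) ^ 3))"

definition rr5 :: "complex \<Rightarrow> complex" where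
  "rr5 q = (let p = \<lambda>i. qpoch (q ^ i) (q ^ 25) in q * (p 5 * p 20) / (p 10 * p 15))"

lemma jtheta_power:
  assumes "q \<noteq> 0" "i \<le> m"
  shows "jtheta (q ^ i) (q ^ m) = qpoch (q ^ i) (q ^ m) * qpoch (q ^ (m - i)) (q ^ m)"
  using assms by (simp add: jtheta_def power_diff)

lemma ell_jtheta:
  assumes "q \<noteq> 0"
  defines "t \<equiv> \<lambda>i::nat. jtheta (q ^ i) (q ^ 10)"
  shows "ell q = t 2 ^ 3 * t 3 ^ 2 / (t 1 ^ 2 * t 4 ^ 3)"
  using jtheta_power[OF assms(1), of 1 10] jtheta_power[OF assms(1), of 2 10]
    jtheta_power[OF assms(1), of 3 10] jtheta_power[OF assms(1), of 4 10]
  by (simp add: t_def ell_def)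

lemma rr5_jtheta:
  assumes "q \<noteq> 0"
  shows "rr5 q = q * jtheta (q ^ 5) (q ^ 25) / jtheta (q ^ 10) (q ^ 25)"
  using jtheta_power[OF assms(1), of 5 25] jtheta_power[OF assms(1), of 10 25]
  by (simp add: rr5_def)

lemma qpoch_0: "qpoch 0 q = 1"
  by (simp add: qpoch_def)

lemma ell_0: "ell 0 = 1"
  by (simp add: ell_def qpoch_0)

lemma holomorphic_ell: "ell holomorphic_on ball 0 1"
  unfolding ell_def Let_def
  by (intro holomorphic_intros holomorphic_qpoch_power) (auto simp: qpoch_power_nonzero qpoch_power_nonzero[of _ 1, simplified])

lemma holomorphic_rr5: "rr5 holomorphic_on ball 0 1"
  unfolding rr5_def Let_def
  by (intro holomorphic_intros holomorphic_qpoch_power) (auto simp: qpoch_power_nonzero)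

text \<open>The dissection and its product over the fifth roots of unity, divided by T2^2 and T2^10
  and expressed in a = q T1 / T2.\<close>

lemma rr5_euler_phi:
  assumes q: "norm q < 1" "q \<noteq> 0"
  defines "a \<equiv> rr5 q"
  shows "a \<noteq> 0"
    and "euler_phi q * a = q * euler_phi (q ^ 25) * (1 - a - a ^ 2)"
    and "euler_phi (q ^ 5) ^ 6 * a ^ 5 = q ^ 5 * euler_phi (q ^ 25) ^ 6 * (1 - 11 * a ^ 5 - a ^ 10)"
proof -
  define T1 where "T1 = jtheta (q ^ 5) (q ^ 25)"
  define T2 where "T2 = jtheta (q ^ 10) (q ^ 25)"
  have nz: "T1 \<noteq> 0" "T2 \<noteq> 0"
    unfolding T1_def T2_def using jtheta_power_nonzero[OF q] by auto
  have a: "a = q * T1 / T2"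
    unfolding a_def rr5_jtheta[OF q(2)] T1_def T2_def ..
  show "a \<noteq> 0" using a nz q by simp
  have "euler_phi q * a * (T2 ^ 2) = q * (euler_phi q * (T1 * T2))"
    unfolding a using nz by (simp add: power2_eq_square)
  also have "\<dots> = q * (euler_phi (q ^ 25) * (T2 ^ 2 - q * (T1 * T2) - q ^ 2 * T1 ^ 2))"
    using euler_phi_dissection[OF q] by (simp add: T1_def T2_def)
  also have "\<dots> = q * euler_phi (q ^ 25) * (1 - a - a ^ 2) * T2 ^ 2"
    unfolding a using nz by (simp add: field_simps power2_eq_square)
  finally show "euler_phi q * a = q * euler_phi (q ^ 25) * (1 - a - a ^ 2)"
    using nz by simp
  have aT: "a * T2 = q * T1" using a nz by simp
  have "euler_phi (q ^ 5) ^ 6 * a ^ 5 * T2 ^ 10 = euler_phi (q ^ 5) ^ 6 * (a * T2) ^ 5 * T2 ^ 5"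
    by (simp add: power_mult_distrib flip: power_add)
  also have "\<dots> = q ^ 5 * (euler_phi (q ^ 5) ^ 6 * (T1 * T2) ^ 5)"
    unfolding aT by (simp add: power_mult_distrib)
  also have "\<dots> = q ^ 5 * (euler_phi (q ^ 25) ^ 6 * (T2 ^ 10 - 11 * (q * T1 * T2) ^ 5 - (q * T1) ^ 10))"
    using euler_phi_sixth_power[OF q] by (simp add: T1_def T2_def mult.assoc)
  also have "\<dots> = q ^ 5 * euler_phi (q ^ 25) ^ 6 * (1 - 11 * a ^ 5 - a ^ 10) * T2 ^ 10"
    unfolding aT[symmetric] by (simp add: power_mult_distrib algebra_simps flip: power_add)
  finally show "euler_phi (q ^ 5) ^ 6 * a ^ 5 = q ^ 5 * euler_phi (q ^ 25) ^ 6 * (1 - 11 * a ^ 5 - a ^ 10)"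
    using nz by simp
qed

text \<open>For q the nome of \<tau>, k is r(\<tau>) r(2\<tau>)^2. The two three-term relations
  evaluate 1 + k and 1 - k as theta quotients, whose ratio is l(\<tau>). It follows that l - 1/l = 4
  k / (1 - k^2), which is an eta quotient.\<close>

lemma ell_k:
  assumes q: "norm q < 1" "q \<noteq> 0"
  defines "t \<equiv> \<lambda>i::nat. jtheta (q ^ i) (q ^ 10)"
  defines "k \<equiv> q * (t 1 * t 2) / (t 3 * t 4)"
  shows "ell q * (1 - k) = 1 + k" and "ell q \<noteq> 0"
    and "(ell q ^ 2 - 1) * (euler_phi (q ^ 2) * euler_phi (q ^ 5) ^ 5) =
           4 * q * ell q * (euler_phi q * euler_phi (q ^ 10) ^ 5)"
proof -
  have nz: "t 1 \<noteq> 0" "t 2 \<noteq> 0" "t 3 \<noteq> 0" "t 4 \<noteq> 0" "t 5 \<noteq> 0"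
    unfolding t_def by (rule jtheta_power_nonzero[OF q]; simp)+
  have id: "t 1 * t 4 * (t 3 * t 4 + q * (t 1 * t 2)) = t 2 ^ 2 * t 3 * t 5"
    "t 2 * t 3 * (t 3 * t 4 - q * (t 1 * t 2)) = t 4 ^ 2 * t 1 * t 5"
    "t 1 * t 3 * (euler_phi (q ^ 5) * euler_phi (q ^ 2)) = euler_phi q * euler_phi (q ^ 10)"
    "t 5 * euler_phi (q ^ 10) ^ 2 = euler_phi (q ^ 5) ^ 2"
    unfolding t_def by (rule level_ten_theta[OF q])+
  define L where "L = ell q"
  have L: "L = t 2 ^ 3 * t 3 ^ 2 / (t 1 ^ 2 * t 4 ^ 3)"
    unfolding L_def t_def by (rule ell_jtheta[OF q(2)])
  show "ell q \<noteq> 0" using L nz by (simp add: L_def)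
  have p: "1 + k = t 2 ^ 2 * t 5 / (t 1 * t 4 ^ 2)"
  proof -
    have "1 + k = (t 1 * t 4 * (t 3 * t 4 + q * (t 1 * t 2))) / (t 1 * t 4 * (t 3 * t 4))"
      using nz by (simp add: k_def field_simps)
    thus ?thesis unfolding id(1) using nz by (simp add: field_simps power2_eq_square)
  qed
  have m: "1 - k = t 4 * t 1 * t 5 / (t 2 * t 3 ^ 2)"
  proof -
    have "1 - k = (t 2 * t 3 * (t 3 * t 4 - q * (t 1 * t 2))) / (t 2 * t 3 * (t 3 * t 4))"
      using nz by (simp add: k_def field_simps)
    thus ?thesis unfolding id(2) using nz by (simp add: field_simps power2_eq_square)
  qed
  have Lk: "L * (1 - k) = 1 + k"
    unfolding p m L using nz by (simp add: field_simps eval_nat_numeral)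
  thus "ell q * (1 - k) = 1 + k" by (simp add: L_def)
  have *: "(L ^ 2 - 1) * ((1 - k) * (1 + k)) = 4 * k * L"
    using Lk by algebra
  \<comment> \<open>The factor t2 / (t4 t3^2) is split off because 4 k contains it as well; it then
    cancels.\<close>
  have "(1 - k) * (1 + k) = t 5 ^ 2 * (t 2 / (t 4 * t 3 ^ 2))"
    unfolding p m using nz by (simp add: field_simps power2_eq_square)
  moreover have "4 * k * L = 4 * q * L * (t 1 * t 3) * (t 2 / (t 4 * t 3 ^ 2))"
    unfolding k_def using nz by (simp add: field_simps power2_eq_square)
  ultimately have "(L ^ 2 - 1) * t 5 ^ 2 * (t 2 / (t 4 * t 3 ^ 2)) = 4 * q * L * (t 1 * t 3) * (t 2 / (t 4 * t 3 ^ 2))"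
    using * by (simp add: mult.assoc)
  hence **: "(L ^ 2 - 1) * t 5 ^ 2 = 4 * q * L * (t 1 * t 3)"
    using nz by simp
  let ?E1 = "euler_phi q" and ?E2 = "euler_phi (q ^ 2)" and ?E5 = "euler_phi (q ^ 5)" and ?E10 = "euler_phi (q ^ 10)"
  have "((L ^ 2 - 1) * (?E2 * ?E5 ^ 5)) = (L ^ 2 - 1) * (?E5 ^ 2) ^ 2 * (?E2 * ?E5)"
    by (simp add: mult_ac eval_nat_numeral)
  also have "\<dots> = ((L ^ 2 - 1) * t 5 ^ 2) * (?E10 ^ 4 * (?E2 * ?E5))"
    unfolding id(4)[symmetric] by (simp add: power_mult_distrib mult_ac flip: power_mult)
  also have "\<dots> = 4 * q * L * ?E10 ^ 4 * (t 1 * t 3 * (?E5 * ?E2))"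
    unfolding ** by (simp add: mult_ac)
  also have "\<dots> = 4 * q * L * (?E1 * ?E10 ^ 5)"
    unfolding id(3) by (simp add: mult_ac eval_nat_numeral)
  finally show "(ell q ^ 2 - 1) * (?E2 * ?E5 ^ 5) = 4 * q * ell q * (?E1 * ?E10 ^ 5)"
    unfolding L_def .
qed

text \<open>With a = r(5\<tau>) and b = r(10\<tau>), the first equation is the definition of l at
  5\<tau>. There k equals a b^2, and inserting b = Y a^2 into \<open>ell_k\<close> gives the
  second.\<close>

lemma rr5_ell:
  assumes q: "norm q < 1" "q \<noteq> 0"
  defines "a \<equiv> rr5 q" and "b \<equiv> rr5 (q ^ 2)" and "Y \<equiv> ell (q ^ 5)"
  shows "b = Y * a ^ 2" and "a ^ 5 * Y ^ 2 * (Y + 1) = Y - 1"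
proof -
  define t where "t = (\<lambda>i::nat. jtheta ((q ^ 5) ^ i) ((q ^ 5) ^ 10))"
  have q5: "norm (q ^ 5) < 1" "q ^ 5 \<noteq> 0"
    using q by (auto simp: norm_power power_less_one_iff)
  have nz: "t 1 \<noteq> 0" "t 2 \<noteq> 0" "t 3 \<noteq> 0" "t 4 \<noteq> 0"
    unfolding t_def by (rule jtheta_power_nonzero[OF q5]; simp)+
  have q25: "norm (q ^ 25) < 1" "q ^ 25 \<noteq> 0"
    using q by (auto simp: norm_power power_less_one_iff)
  have T1: "jtheta (q ^ 5) (q ^ 25) = t 1 * t 4"
    using jtheta_split[OF q25, of "q ^ 5"] q jtheta_reflect_power[of q 30 20 50]
    by (simp add: t_def flip: power_mult power_add)
  have T2: "jtheta (q ^ 10) (q ^ 25) = t 2 * t 3"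
    using jtheta_split[OF q25, of "q ^ 10"] q jtheta_reflect_power[of q 35 15 50]
    by (simp add: t_def flip: power_mult power_add)
  have a: "a = q * (t 1 * t 4) / (t 2 * t 3)"
    unfolding a_def rr5_jtheta[OF q(2)] T1 T2 ..
  have b: "b = q ^ 2 * t 2 / t 4"
    unfolding b_def using rr5_jtheta[of "q ^ 2"] q by (simp add: t_def flip: power_mult)
  have Y: "Y = t 2 ^ 3 * t 3 ^ 2 / (t 1 ^ 2 * t 4 ^ 3)"
    unfolding Y_def t_def by (rule ell_jtheta[OF q5(2)])
  show ba: "b = Y * a ^ 2"
    unfolding a b Y using nz by (simp add: field_simps eval_nat_numeral)
  define k where "k = q ^ 5 * (t 1 * t 2) / (t 3 * t 4)"
  have k: "a * b ^ 2 = k"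
    unfolding a b k_def using nz by (simp add: field_simps eval_nat_numeral)
  have "Y * (1 - k) = 1 + k"
    using ell_k(1)[OF q5] unfolding Y_def k_def t_def .
  hence "k * (Y + 1) = Y - 1" by (simp add: algebra_simps)
  moreover have "a ^ 5 * Y ^ 2 = k"
    unfolding k[symmetric] ba by (simp add: eval_nat_numeral mult_ac)
  ultimately show "a ^ 5 * Y ^ 2 * (Y + 1) = Y - 1" by simp
qed


text \<open>X - 1/X is 4 eta(\<tau>) eta(10\<tau>)^5 / (eta(2\<tau>) eta(5\<tau>)^5). The dissection
  replaces eta(\<tau>) by eta(25\<tau>) and eta(2\<tau>) by eta(50\<tau>). The eta quotient that
  remains is a rational function of Y, found from Y - 1/Y and the two sixth-power formulas.\<close>

lemma ell_quadratic:
  assumes q: "norm q < 1" "q \<noteq> 0"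
  defines "a \<equiv> rr5 q" and "b \<equiv> rr5 (q ^ 2)" and "X \<equiv> ell q" and "Y \<equiv> ell (q ^ 5)"
  shows "(X ^ 2 - 1) * (1 - b - b ^ 2) * (1 + Y - Y ^ 2) = X * (1 - a - a ^ 2) * Y * a * (Y ^ 2 + 4 * Y - 1)"
proof -
  define E where "E = (\<lambda>n. euler_phi (q ^ n))"
  have qn: "norm (q ^ n) < 1" "q ^ n \<noteq> 0" if "n > 0" for n
    using q that by (auto simp: norm_power power_less_one_iff)
  have E: "E n \<noteq> 0" if "n > 0" for n
    unfolding E_def using euler_phi_nonzero[OF qn(1)[OF that]] .
  have a0: "a \<noteq> 0" unfolding a_def by (rule rr5_euler_phi(1)[OF q])
  have Y0: "Y \<noteq> 0" unfolding Y_def by (rule ell_k(2)[OF qn]) auto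
  have ba: "b = Y * a ^ 2" and rel: "a ^ 5 * Y ^ 2 * (Y + 1) = Y - 1"
    unfolding a_def b_def Y_def using rr5_ell[OF q] by auto
  have a1: "E 1 * a = q * E 25 * (1 - a - a ^ 2)"
    and a6: "E 5 ^ 6 * a ^ 5 = q ^ 5 * E 25 ^ 6 * (1 - 11 * a ^ 5 - a ^ 10)"
    unfolding E_def a_def using rr5_euler_phi[OF q] by auto
  have b1: "E 2 * b = q ^ 2 * E 50 * (1 - b - b ^ 2)"
    and b6: "E 10 ^ 6 * b ^ 5 = q ^ 10 * E 50 ^ 6 * (1 - 11 * b ^ 5 - b ^ 10)"
    unfolding E_def b_def using rr5_euler_phi[OF qn, of 2] by (simp_all flip: power_mult)
  have X1: "(X ^ 2 - 1) * (E 2 * E 5 ^ 5) = 4 * q * X * (E 1 * E 10 ^ 5)"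
    unfolding E_def X_def using ell_k(3)[OF q] by simp
  have Y1: "(Y ^ 2 - 1) * (E 10 * E 25 ^ 5) = 4 * q ^ 5 * Y * (E 5 * E 50 ^ 5)"
    unfolding E_def Y_def using ell_k(3)[OF qn, of 5] by (simp flip: power_mult)
  \<comment> \<open>In terms of c the relation between a and Y is linear, and b^5 = Y^5 c^2.\<close>
  define c where "c = a ^ 5"
  define \<sigma> where "\<sigma> = 1 - 11 * c - c ^ 2"
  define \<sigma>' where "\<sigma>' = 1 - 11 * (Y ^ 5 * c ^ 2) - (Y ^ 5 * c ^ 2) ^ 2"
  have c: "a ^ 5 = c" "a ^ 10 = c ^ 2" "b ^ 5 = Y ^ 5 * c ^ 2" "b ^ 10 = (Y ^ 5 * c ^ 2) ^ 2"
    unfolding c_def ba by (simp_all add: power_mult_distrib flip: power_mult)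
  have c0: "c \<noteq> 0" using a0 by (simp add: c_def)
  note a6 = a6[unfolded c, folded \<sigma>_def] and b6 = b6[unfolded c, folded \<sigma>'_def]
  have \<sigma>0: "\<sigma> \<noteq> 0" using a6 E[of 5] c0 by auto
  have rel': "c * Y ^ 2 * (Y + 1) = Y - 1" using rel by (simp add: c_def)
  \<comment> \<open>The relation reduces the ratio of \<open>\<sigma>'\<close> to
    \<open>\<sigma>\<close> so that, up to powers of Y and c, it depends on Y alone.\<close>
  have \<sigma>\<sigma>: "\<sigma>' * (Y ^ 2 - 1) * (1 + Y - Y ^ 2) = \<sigma> * Y ^ 6 * c * (Y ^ 2 + 4 * Y - 1)"
    unfolding \<sigma>_def \<sigma>'_def using rel' by algebra
  \<comment> \<open>\<open>a6\<close>, \<open>Y1\<close> and \<open>b6\<close> are inserted in turn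
    to express the remaining eta quotient by \<open>\<sigma>\<close> and
    \<open>\<sigma>'\<close>.\<close>
  have "q ^ 10 * E 25 ^ 5 * E 50 ^ 5 * (4 * E 25 * E 10 ^ 5 * (\<sigma> * Y ^ 6 * c)) =
      4 * q ^ 5 * E 50 ^ 5 * E 10 ^ 5 * Y ^ 6 * c * (q ^ 5 * E 25 ^ 6 * \<sigma>)"
    by (simp add: eval_nat_numeral mult_ac)
  also have "\<dots> = E 10 ^ 5 * E 5 ^ 5 * Y ^ 5 * c ^ 2 * (4 * q ^ 5 * Y * (E 5 * E 50 ^ 5))"
    unfolding a6[symmetric] by (simp add: eval_nat_numeral mult_ac)
  also have "\<dots> = E 5 ^ 5 * (Y ^ 2 - 1) * E 25 ^ 5 * (E 10 ^ 6 * (Y ^ 5 * c ^ 2))"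
    unfolding Y1[symmetric] by (simp add: eval_nat_numeral mult_ac)
  also have "\<dots> = q ^ 10 * E 25 ^ 5 * E 50 ^ 5 * (E 50 * E 5 ^ 5 * (\<sigma>' * (Y ^ 2 - 1)))"
    unfolding b6 by (simp add: eval_nat_numeral mult_ac)
  finally have K: "4 * E 25 * E 10 ^ 5 * (\<sigma> * Y ^ 6 * c) = E 50 * E 5 ^ 5 * (\<sigma>' * (Y ^ 2 - 1))"
    using q E by simp
  have "(\<sigma> * Y ^ 6 * c) * (4 * E 25 * E 10 ^ 5 * (1 + Y - Y ^ 2)) =
      (4 * E 25 * E 10 ^ 5 * (\<sigma> * Y ^ 6 * c)) * (1 + Y - Y ^ 2)"
    by (simp only: mult_ac)
  also have "\<dots> = E 50 * E 5 ^ 5 * (\<sigma>' * (Y ^ 2 - 1) * (1 + Y - Y ^ 2))"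
    unfolding K by (simp only: mult_ac)
  also have "\<dots> = (\<sigma> * Y ^ 6 * c) * (E 50 * E 5 ^ 5 * (Y ^ 2 + 4 * Y - 1))"
    unfolding \<sigma>\<sigma> by (simp add: mult_ac)
  finally have star: "4 * E 25 * E 10 ^ 5 * (1 + Y - Y ^ 2) = E 50 * E 5 ^ 5 * (Y ^ 2 + 4 * Y - 1)"
    using \<sigma>0 Y0 c0 by simp
  have "q ^ 2 * (a * E 50 * E 5 ^ 5 * ((X ^ 2 - 1) * (1 - b - b ^ 2) * (1 + Y - Y ^ 2))) =
     (X ^ 2 - 1) * E 5 ^ 5 * a * (q ^ 2 * E 50 * (1 - b - b ^ 2)) * (1 + Y - Y ^ 2)"
    by (simp add: mult_ac)
  also have "\<dots> = ((X ^ 2 - 1) * (E 2 * E 5 ^ 5)) * a * b * (1 + Y - Y ^ 2)"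
    unfolding b1[symmetric] by (simp add: mult_ac)
  also have "\<dots> = 4 * q * X * E 10 ^ 5 * (E 1 * a) * b * (1 + Y - Y ^ 2)"
    unfolding X1 by (simp add: mult_ac)
  also have "\<dots> = q ^ 2 * X * (1 - a - a ^ 2) * b * (4 * E 25 * E 10 ^ 5 * (1 + Y - Y ^ 2))"
    unfolding a1 by (simp add: power2_eq_square mult_ac)
  also have "\<dots> = q ^ 2 * (a * E 50 * E 5 ^ 5 * (X * (1 - a - a ^ 2) * Y * a * (Y ^ 2 + 4 * Y - 1)))"
    unfolding star unfolding ba by (simp add: power2_eq_square mult_ac)
  finally show ?thesis
    using q a0 E by simp
qed

lemma holomorphic_compose_power:
  assumes "f holomorphic_on ball 0 1" "0 < n"
  shows "(\<lambda>q. f (q ^ n)) holomorphic_on ball (0 :: complex) 1"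
proof -
  have "(f \<circ> (\<lambda>q. q ^ n)) holomorphic_on ball 0 1"
  proof (rule holomorphic_on_compose_gen[OF _ assms(1)])
    show "(\<lambda>q. q ^ n) ` ball 0 1 \<subseteq> ball (0 :: complex) 1"
      using assms(2) by (auto simp: norm_power power_less_one_iff)
  qed (intro holomorphic_intros)
  thus ?thesis by (simp add: o_def)
qed

theorem ell_quintic:
  assumes "norm q < 1"
  defines "P \<equiv> \<lambda>q. (ell q ^ 5 - ell (q ^ 5)) * (ell (q ^ 5) ^ 2 - ell (q ^ 5) - 1) ^ 2"
    and "R \<equiv> \<lambda>q. - 5 * ell q * ell (q ^ 5) * rr_P (ell q) (ell (q ^ 5))"
  shows "P q = R q"
proof -
  define N where "N = (\<lambda>q. 1 + 2 * rr5 q + ell (q ^ 5) * rr5 q ^ 2 + ell (q ^ 5) * rr5 q ^ 4)"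
  define D where "D = (\<lambda>q. 1 + rr5 q ^ 2 + 2 * ell (q ^ 5) * rr5 q ^ 3 - ell (q ^ 5) * rr5 q ^ 4)"
  \<comment> \<open>The product of all that must not vanish: two factors to cancel from the
    quadratic equation, X N + D to rule out X = -D / N, and D to divide by. At q = 0 one has a = b =
    0 and X = Y = 1, hence the value 2.\<close>
  define g where "g = (\<lambda>q. (1 - rr5 (q ^ 2) - rr5 (q ^ 2) ^ 2) * (1 + ell (q ^ 5) - ell (q ^ 5) ^ 2) *
    (ell q * N q + D q) * D q)"
  note hol = holomorphic_ell holomorphic_rr5
    holomorphic_compose_power[OF holomorphic_ell, of 5, simplified]
    holomorphic_compose_power[OF holomorphic_rr5, of 2, simplified]
  have "g holomorphic_on ball 0 1"
    unfolding g_def N_def D_def by (intro holomorphic_intros hol)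
  hence "isCont g 0"
    by (intro continuous_on_interior[OF holomorphic_on_imp_continuous_on]) auto
  moreover have "g 0 = 2"
    by (simp add: g_def N_def D_def ell_0 rr5_def)
  ultimately have "eventually (\<lambda>q. g q \<noteq> 0) (at 0)"
    by (intro tendsto_imp_eventually_ne[where c = 2]) (auto simp: isCont_def)
  then obtain \<epsilon> where \<epsilon>: "\<epsilon> > 0" "\<And>q. q \<noteq> 0 \<Longrightarrow> norm q < \<epsilon> \<Longrightarrow> g q \<noteq> 0"
    by (auto simp: eventually_at dist_norm)
  have loc: "P q = R q" if q: "q \<noteq> 0" "norm q < \<epsilon>" "norm q < 1" for q
  proof -
    define a where "a = rr5 q"
    define b where "b = rr5 (q ^ 2)"
    define X where "X = ell q"
    define Y where "Y = ell (q ^ 5)"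
    have nz: "1 - b - b ^ 2 \<noteq> 0" "1 + Y - Y ^ 2 \<noteq> 0" "X * N q + D q \<noteq> 0" "D q \<noteq> 0"
      using \<epsilon>(2)[OF q(1,2)] by (auto simp: g_def b_def X_def Y_def)
    have ND: "N q = 1 + 2 * a + Y * a ^ 2 + Y * a ^ 4" "D q = 1 + a ^ 2 + 2 * Y * a ^ 3 - Y * a ^ 4"
      by (simp_all add: N_def D_def a_def Y_def)
    have ba: "b = Y * a ^ 2" and rel: "a ^ 5 * Y ^ 2 * (Y + 1) = Y - 1"
      unfolding a_def b_def Y_def using rr5_ell[OF q(3,1)] by auto
    have 1: "(X ^ 2 - 1) * (1 - b - b ^ 2) * (1 + Y - Y ^ 2) = X * (1 - a - a ^ 2) * Y * a * (Y ^ 2 + 4 * Y - 1)"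
      unfolding a_def b_def X_def Y_def by (rule ell_quadratic[OF q(3,1)])
    have 2: "(N q ^ 2 - D q ^ 2) * (1 - b - b ^ 2) * (1 + Y - Y ^ 2) =
        N q * D q * (1 - a - a ^ 2) * Y * a * (Y ^ 2 + 4 * Y - 1)"
      unfolding ND ba by (rule resolvent_quadratic[OF rel])
    have "((X ^ 2 - 1) * (N q * D q)) * ((1 - b - b ^ 2) * (1 + Y - Y ^ 2)) =
        N q * D q * ((X ^ 2 - 1) * (1 - b - b ^ 2) * (1 + Y - Y ^ 2))"
      by (simp add: mult_ac)
    also have "\<dots> = X * (N q * D q * (1 - a - a ^ 2) * Y * a * (Y ^ 2 + 4 * Y - 1))"
      unfolding 1 by (simp add: mult_ac)
    also have "\<dots> = (X * (N q ^ 2 - D q ^ 2)) * ((1 - b - b ^ 2) * (1 + Y - Y ^ 2))"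
      unfolding 2[symmetric] by (simp add: mult_ac)
    finally have "(X ^ 2 - 1) * (N q * D q) = X * (N q ^ 2 - D q ^ 2)"
      using nz by simp
    \<comment> \<open>The quadratic equation has the roots N / D and -D / N; near 0 the second
      factor is nonzero.\<close>
    hence "(X * D q - N q) * (X * N q + D q) = 0"
      by (simp add: algebra_simps power2_eq_square)
    hence XD: "N q = X * D q" using nz by simp
    have "D q ^ 5 * P q = (N q ^ 5 - Y * D q ^ 5) * (Y ^ 2 - Y - 1) ^ 2"
      unfolding XD P_def X_def[symmetric] Y_def[symmetric] by (simp add: power_mult_distrib algebra_simps)
    also have "\<dots> = - 5 * N q * Y * ((Y ^ 2 - Y - 1) * Y * N q ^ 3 * D q + (3 * Y ^ 2 + 2 * Y - 3) * N q ^ 2 * D q ^ 2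
      - (3 * Y ^ 2 + 2 * Y - 3) * Y * N q * D q ^ 3 - (Y ^ 2 - Y - 1) * D q ^ 4)"
      unfolding ND by (rule resolvent_quintic[OF rel])
    also have "\<dots> = D q ^ 5 * R q"
      unfolding XD R_def rr_P_def X_def[symmetric] Y_def[symmetric] by algebra
    finally show ?thesis using nz by simp
  qed
  show ?thesis
  \<comment> \<open>The centre is removed from the small disc because the relations for a and Y
    require q \<noteq> 0.\<close>
  proof (rule analytic_continuation_open[of "ball 0 (min \<epsilon> 1) - {0}" "ball 0 1" P R])
    show "ball 0 (min \<epsilon> 1) - {0 :: complex} \<noteq> {}"
    proof -
      have "complex_of_real (min \<epsilon> 1 / 2) \<in> ball 0 (min \<epsilon> 1) - {0}"
        using \<epsilon>(1) by (auto simp: min_def)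
      thus ?thesis by blast
    qed
    show "P holomorphic_on ball 0 1" "R holomorphic_on ball 0 1"
      unfolding P_def R_def rr_P_def by (intro holomorphic_intros hol)+
    show "P z = R z" if "z \<in> ball 0 (min \<epsilon> 1) - {0}" for z
      using that by (intro loc) auto
  qed (use assms in \<open>auto simp: open_delete\<close>)
qed

section \<open>From the nome back to the upper half plane\<close>

lemma nome_power: "nome (of_nat n * \<tau>) = nome \<tau> ^ n"
  by (simp add: nome_def mult_ac flip: exp_of_nat_mult)

lemma norm_nome_less_1: "Im \<tau> > 0 \<Longrightarrow> norm (nome \<tau>) < 1"
  by (simp add: nome_def)

lemma rr_cfrac_qpoch:
  assumes "Im \<tau> > 0"
  defines "p \<equiv> \<lambda>i. qpoch (nome \<tau> ^ i) (nome \<tau> ^ 5)"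
  shows "rr_cfrac \<tau> = exp (2 * complex_of_real pi * \<i> * \<tau> / 5) * ((p 4 * p 1) / (p 3 * p 2))"
proof -
  let ?q = "nome \<tau>"
  have q5: "norm (?q ^ 5) < 1"
    using norm_nome_less_1[OF assms(1)] by (simp add: norm_power power_less_one_iff)
  \<comment> \<open>With n counted from 0 the exponents become 5 - i + 5 n, so i = 1, 4, 2, 3 lead
    to \<open>p 4\<close>, \<open>p 1\<close>, \<open>p 3\<close>, \<open>p 2\<close>.\<close>
  have e: "?q ^ (5 * Suc n - i) = ?q ^ (5 - i) * (?q ^ 5) ^ n" if "i \<le> 5" for n i
  proof -
    have "5 * Suc n - i = (5 - i) + 5 * n" using that by simp
    thus ?thesis by (simp only: power_add power_mult)
  qed
  have P: "(\<lambda>n. 1 - ?q ^ i * (?q ^ 5) ^ n) has_prod p i" for i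
    unfolding p_def by (rule has_prod_qpoch[OF q5])
  have "(\<lambda>n. ((1 - ?q ^ (5 * Suc n - 1)) * (1 - ?q ^ (5 * Suc n - 4))) /
           ((1 - ?q ^ (5 * Suc n - 2)) * (1 - ?q ^ (5 * Suc n - 3)))) has_prod ((p 4 * p 1) / (p 3 * p 2))"
    using has_prod_divide[OF has_prod_mult[OF P[of 4] P[of 1]] has_prod_mult[OF P[of 3] P[of 2]]]
    by (simp add: e del: mult_Suc_right)
  thus ?thesis
    unfolding rr_cfrac_def by (simp add: has_prod_iff)
qed

text \<open>The products of r(\<tau>) have base q^5 and are split to base q^10, which r(2\<tau>) has
  already. The fifth-root prefactors cancel, leaving a function of the nome alone.\<close>

lemma rr_l_ell:
  assumes "Im \<tau> > 0"
  shows "rr_l \<tau> = ell (nome \<tau>)"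
proof -
  define q where "q = nome \<tau>"
  have q: "norm q < 1" unfolding q_def using norm_nome_less_1[OF assms] .
  define p where "p = (\<lambda>i. qpoch (q ^ i) (q ^ 10))"
  have nz: "p i \<noteq> 0" if "i > 0" for i
    unfolding p_def using q that by (intro qpoch_power_nonzero) auto
  have p5: "qpoch (q ^ i) (q ^ 5) = p i * p (i + 5)" for i
    using qpoch_power_split[OF q, of 5 2 i] by (simp add: p_def lessThan_nat_numeral)
  have n2: "nome (2 * \<tau>) = q ^ 2"
    using nome_power[of 2 \<tau>] by (simp add: q_def)
  define x where "x = exp (2 * complex_of_real pi * \<i> * \<tau> / 5)"
  have r1: "rr_cfrac \<tau> = x * ((p 4 * p 9 * (p 1 * p 6)) / (p 3 * p 8 * (p 2 * p 7)))"
    using rr_cfrac_qpoch[OF assms] p5[of 1] p5[of 2] p5[of 3] p5[of 4] by (simp add: x_def flip: q_def)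
  have r2: "rr_cfrac (2 * \<tau>) = x ^ 2 * ((p 8 * p 2) / (p 6 * p 4))"
  proof -
    have "x ^ 2 = exp (2 * complex_of_real pi * \<i> * (2 * \<tau>) / 5)"
      unfolding x_def by (simp flip: exp_double add: mult_ac)
    thus ?thesis
      using rr_cfrac_qpoch[of "2 * \<tau>"] assms by (simp add: n2 p_def flip: power_mult)
  qed
  have "x \<noteq> 0" by (simp add: x_def)
  hence "rr_l \<tau> = (p 2 * p 8) ^ 3 * (p 3 * p 7) ^ 2 / ((p 1 * p 9) ^ 2 * (p 4 * p 6) ^ 3)"
    unfolding rr_l_def r1 r2 using nz by (simp add: field_simps eval_nat_numeral)
  thus ?thesis
    unfolding ell_def Let_def p_def q_def .
qed

theorem theorem4p6:
  fixes \<tau> :: complex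
  assumes "Im \<tau> > 0"
  shows "(rr_l \<tau> ^ 5 - rr_l (5 * \<tau>)) * (rr_l (5 * \<tau>) ^ 2 - rr_l (5 * \<tau>) - 1) ^ 2
    = - 5 * rr_l \<tau> * rr_l (5 * \<tau>) * rr_P (rr_l \<tau>) (rr_l (5 * \<tau>))"
proof -
  have "rr_l (5 * \<tau>) = ell (nome \<tau> ^ 5)"
    using rr_l_ell[of "5 * \<tau>"] nome_power[of 5 \<tau>] assms by simp
  thus ?thesis
    using ell_quintic[OF norm_nome_less_1[OF assms]] rr_l_ell[OF assms] by simp
qed

end
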